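(* Let $A\in M_n(\mathbb{C})$, let $d_n=n(n+1)(n+2)$, and consider the random variable $f_A(\xi)=\langle A\xi,\xi\rangle$ on the probability space $(\mathbb{S}^n,\sigma)$. For any real $\alpha\ge0$, \begin{align*} &3d_n\,E(|f_A|^4)+n\,d_n\,\mu_4^4(f_A)+4\alpha n^2(n+1)^2\,V^2(f_A)=\\ &\ 4\lVert A^2\rVert_F^2+2\lVert A\rVert_{(4)}^4+(2+4\alpha)\lVert A\rVert_F^4+\frac4n\,\Re\Big[\mathrm{tr}(A^2)\big[\mathrm{tr}A^\star\big]^2\Big]+\frac8n(1-\alpha)\lVert A\rVert_F^2\,|\mathrm{tr}(A)|^2\\ &+|\mathrm{tr}(A^2)|^2+\frac{3n-6+4\alpha}{n^2}\,|\mathrm{tr}(A)|^4, \end{align*} where $E$ is the expectation, $V(f)=E(|f-E(f)|^2)$ is the variance (and $V^2(f)=(V(f))^2$), and $\mu_4^4(f)=E(|f-E(f)|^4)$ is the fourth central moment.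
   Context: $\mathbb{S}^n$ is the unit sphere of $\mathbb{C}^n$, $\sigma$ the normalized Euclidean surface measure on it, $\langle\cdot,\cdot\rangle$ the standard Hermitian inner product. $\lVert\cdot\rVert_F$ is the Frobenius norm, $\lVert A\rVert_{(4)}=[\mathrm{tr}(|A|^4)]^{1/4}$ with $|A|=\sqrt{A^\star A}$ is the Schatten 4-norm, $A^\star$ is the conjugate transpose, $\Re$ the real part. *)

theory Defs
  imports "HOL-Probability.Probability"
begin

definition hinner :: "complex ^ 'n \<Rightarrow> complex ^ 'n \<Rightarrow> complex" where
  "hinner x y = (\<Sum>i\<in>UNIV. x $ i * cnj (y $ i))"

definition ctranspose :: "complex ^ 'n ^ 'n \<Rightarrow> complex ^ 'n ^ 'n" where
  "ctranspose A = (\<chi> i j. cnj (A $ j $ i))"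

definition frobenius_norm :: "complex ^ 'n ^ 'n \<Rightarrow> real" where
  "frobenius_norm A = sqrt (\<Sum>i\<in>UNIV. \<Sum>j\<in>UNIV. (cmod (A $ i $ j))\<^sup>2)"

definition psd :: "complex ^ 'n ^ 'n \<Rightarrow> bool" where
  "psd B \<longleftrightarrow> ctranspose B = B \<and> (\<forall>x. 0 \<le> Re (hinner (B *v x) x))"

text \<open>Every positive semidefinite matrix has exactly one positive semidefinite square root.\<close>

definition psd_sqrt :: "complex ^ 'n ^ 'n \<Rightarrow> complex ^ 'n ^ 'n" where
  "psd_sqrt P = (THE B. psd B \<and> B ** B = P)"

definition matrix_abs :: "complex ^ 'n ^ 'n \<Rightarrow> complex ^ 'n ^ 'n" where
  "matrix_abs A = psd_sqrt (ctranspose A ** A)"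

text \<open>The trace below is a nonnegative real number, so taking its real part only changes the type.
  Powers of matrices are written out, since the product \<open>*\<close> and the power \<open>^\<close> on vectors and
  matrices are componentwise.\<close>

definition schatten4_norm :: "complex ^ 'n ^ 'n \<Rightarrow> real" where
  "schatten4_norm A =
     Re (trace (matrix_abs A ** matrix_abs A ** matrix_abs A ** matrix_abs A)) powr (1 / 4)"

text \<open>The normalized surface measure of a Borel subset \<open>B\<close> of the unit sphere is the volume of the
  cone \<open>{t *\<^sub>R x | t x. 0 < t \<and> t < 1 \<and> x \<in> B}\<close> divided by the volume of the unit ball (integration in
  polar coordinates), that is, the image under radial projection of the uniform distribution on
  the ball. The projection sends only the origin, a null set, outside the sphere. The Euclidean
  structure on \<open>complex ^ 'n\<close> is that of the underlying real vector space.\<close>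

definition sphere_measure :: "'a::euclidean_space measure" where
  "sphere_measure =
     restrict_space (distr (uniform_measure lborel (ball 0 1)) borel (\<lambda>x. x /\<^sub>R norm x)) (sphere 0 1)"

lemma space_sphere_measure: "space sphere_measure = sphere 0 1"
  by (simp add: sphere_measure_def space_restrict_space)

lemma sets_sphere_measure: "sets sphere_measure = sets (restrict_space borel (sphere 0 1))"
  by (simp add: sphere_measure_def sets_restrict_space)

lemma prob_space_sphere_measure: "prob_space (sphere_measure :: 'a::euclidean_space measure)"
proof -
  let ?U = "uniform_measure lborel (ball 0 1) :: 'a measure"
  let ?D = "distr ?U borel (\<lambda>x. x /\<^sub>R norm x)"
  have fin: "emeasure lborel (ball 0 1 :: 'a set) \<noteq> \<infinity>"
    using emeasure_bounded_finite[of "ball 0 1 :: 'a set"] by auto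
  have pos: "emeasure lborel (ball 0 1 :: 'a set) \<noteq> 0"
    by (simp add: emeasure_ball unit_ball_vol_pos less_imp_neq[OF unit_ball_vol_pos, symmetric])
  interpret U: prob_space ?U
    using prob_space_uniform_measure[OF pos fin] .
  have meas: "(\<lambda>x. x /\<^sub>R norm x) \<in> ?U \<rightarrow>\<^sub>M borel"
    by measurable
  interpret D: prob_space ?D
    by (rule U.prob_space_distr[OF meas])
  have "AE x in lborel. (x::'a) \<noteq> 0"
    by (rule AE_lborel_singleton)
  then have "AE x in ?U. x \<noteq> 0"
    by (intro AE_uniform_measureI) auto
  then have "AE x in ?U. x /\<^sub>R norm x \<in> sphere 0 1"
    by eventually_elim (auto simp: dist_norm)
  then have ae: "AE y in ?D. y \<in> sphere 0 1"
    by (subst AE_distr_iff[OF meas]) auto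
  have "emeasure ?D (sphere 0 1) = 1"
    by (rule D.emeasure_eq_1_AE[OF _ ae]) auto
  then show ?thesis
    by (intro prob_spaceI)
       (simp add: sphere_measure_def space_restrict_space emeasure_restrict_space)
qed

definition quad_form :: "complex ^ 'n ^ 'n \<Rightarrow> complex ^ 'n \<Rightarrow> complex" where
  "quad_form A \<xi> = hinner (A *v \<xi>) \<xi>"

text \<open>The library's \<open>prob_space.variance\<close> is restricted to real-valued random variables.\<close>

definition cvariance :: "'a measure \<Rightarrow> ('a \<Rightarrow> complex) \<Rightarrow> real" where
  "cvariance M f = (\<integral>x. (cmod (f x - (\<integral>y. f y \<partial>M)))\<^sup>2 \<partial>M)"

definition central_moment4 :: "'a measure \<Rightarrow> ('a \<Rightarrow> complex) \<Rightarrow> real" where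
  "central_moment4 M f = (\<integral>x. (cmod (f x - (\<integral>y. f y \<partial>M))) ^ 4 \<partial>M)"

end

theory Submission
  imports Defs
begin

text \<open>
  Write \<open>f\<^sub>A\<close> for the quadratic form of \<open>A\<close>. The only property of \<open>\<sigma>\<close> that matters is invariance under unitary
  maps. Differentiating \<open>E(f\<^sub>A f\<^sub>B f\<^sub>C f\<^sub>D)\<close> along the unitary group replaces each matrix in turn by its
  commutator with some \<open>X\<close>, and the resulting sum vanishes; it is complex linear in \<open>X\<close>, so \<open>X\<close> may be
  any matrix unit \<open>E\<^sub>i\<^sub>j\<close>. Taking \<open>A E\<^sub>j\<^sub>i\<close> for the first matrix and summing over \<open>i, j\<close> gives
  \<open>(n + 3) E(f\<^sub>A f\<^sub>B f\<^sub>C f\<^sub>D) = tr A E(f\<^sub>B f\<^sub>C f\<^sub>D) + E(f\<^sub>A\<^sub>B f\<^sub>C f\<^sub>D) + E(f\<^sub>B f\<^sub>A\<^sub>C f\<^sub>D) + E(f\<^sub>B f\<^sub>C f\<^sub>A\<^sub>D)\<close>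
  on the sphere, where the form of the identity is \<open>1\<close>, so shorter moments are the case of identity arguments.
  Iterating expresses all moments up to order four by traces. In the combination of the theorem the
  terms in \<open>tr(A\<^sup>2 A\<^sup>*) cnj (tr A)\<close> cancel.
\<close>

subsection \<open>Unitary invariance of the surface measure\<close>

lemma lborel_distr_translation: "distr lborel borel ((+) t) = (lborel :: 'a::euclidean_space measure)"
  using lborel_affine_euclidean[of "\<lambda>_. 1" t]
  by (simp add: density_1 euclidean_representation)

lemma nn_integral_lborel_translation:
  fixes g :: "'a::euclidean_space \<Rightarrow> ennreal"
  assumes [measurable]: "g \<in> borel_measurable borel"
  shows "(\<integral>\<^sup>+x. g (t + x) \<partial>lborel) = (\<integral>\<^sup>+x. g x \<partial>lborel)"
  by (subst (2) lborel_distr_translation[symmetric, of t]) (simp add: nn_integral_distr)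

text \<open>\<open>N = distr lborel borel U\<close> is again translation invariant. Evaluating \<open>N A * lborel B\<close> by Fubini and
  translating in either variable gives \<open>N A * lborel B = lborel A * N (- B)\<close>; now let \<open>B\<close> be the unit ball.\<close>

lemma distr_lborel_orthogonal_transformation:
  fixes U :: "'a::euclidean_space \<Rightarrow> 'a"
  assumes U: "orthogonal_transformation U"
  shows "distr lborel borel U = lborel"
proof -
  define N where "N = distr lborel borel U"
  have lin: "linear U" and bij: "bij U"
    using U by (auto simp: orthogonal_transformation orthogonal_transformation_bij)
  have [measurable]: "U \<in> borel_measurable borel"
    using lin by (intro borel_measurable_continuous_onI linear_continuous_on linear_conv_bounded_linear[THEN iffD1])
  have "orthogonal_transformation (inv U)"
    by (rule orthogonal_transformation_inv[OF U])
  then have [measurable]: "inv U \<in> borel_measurable borel"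
    by (intro borel_measurable_continuous_onI linear_continuous_on linear_conv_bounded_linear[THEN iffD1])
       (auto simp: orthogonal_transformation)
  have setsN[simp, measurable_cong]: "sets N = sets borel" by (simp add: N_def)
  \<comment> \<open>Fubini needs \<open>N\<close> to be sigma-finite. This is pulled back from
    \<open>lborel\<close>, the image of \<open>N\<close> under \<open>inv U\<close>.\<close>
  have "distr N borel (inv U) = lborel"
    unfolding N_def using bij by (subst distr_distr) (auto simp: comp_def bij_is_inj distr_id2)
  then have "sigma_finite_measure (distr N borel (inv U))"
    by (simp add: lborel.sigma_finite_measure_axioms)
  then interpret N: sigma_finite_measure N
    by (rule sigma_finite_measure_distr) simp
  interpret P: pair_sigma_finite N lborel ..
  have N_trans: "(\<integral>\<^sup>+x. g (t + x) \<partial>N) = (\<integral>\<^sup>+x. g x \<partial>N)"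
    if [measurable]: "g \<in> borel_measurable borel" for g :: "'a \<Rightarrow> ennreal" and t
  proof -
    \<comment> \<open>Shifting the image of \<open>U\<close> by \<open>t\<close> is shifting its
      argument by \<open>inv U t\<close>, which reduces the claim to \<open>lborel\<close>.\<close>
    have t: "t = U (inv U t)" using bij by (simp add: bij_is_surj surj_f_inv_f)
    have "(\<integral>\<^sup>+x. g (t + x) \<partial>N) = (\<integral>\<^sup>+x. g (t + U x) \<partial>lborel)"
      by (simp add: N_def nn_integral_distr)
    also have "\<dots> = (\<integral>\<^sup>+x. g (U (inv U t + x)) \<partial>lborel)"
      by (subst t) (simp only: linear_add[OF lin])
    also have "\<dots> = (\<integral>\<^sup>+x. g (U x) \<partial>lborel)"
      by (rule nn_integral_lborel_translation) simp
    finally show ?thesis by (simp add: N_def nn_integral_distr)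
  qed
  \<comment> \<open>The ball is invariant under negation and under \<open>U\<close>, and its volume
    is positive and finite, so it can be cancelled at the end.\<close>
  define B where "B = ball (0::'a) 1"
  have [measurable]: "B \<in> sets borel" by (simp add: B_def)
  have minus: "- x \<in> B \<longleftrightarrow> x \<in> B" for x by (simp add: B_def)
  have NB: "emeasure N B = emeasure lborel B"
  proof -
    have "U -` B = B" using U by (auto simp: B_def orthogonal_transformation)
    then show ?thesis by (simp add: N_def emeasure_distr)
  qed
  have B_nz: "emeasure lborel B \<noteq> 0"
    by (simp add: B_def emeasure_ball less_imp_neq[OF unit_ball_vol_pos, symmetric])
  have B_fin: "emeasure lborel B \<noteq> \<infinity>"
    using emeasure_bounded_finite[of B] by (auto simp: B_def)
  have "emeasure N A = emeasure lborel A" if [measurable]: "A \<in> sets borel" for A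
  proof -
    let ?i = "indicator :: 'a set \<Rightarrow> 'a \<Rightarrow> ennreal"
    have "emeasure N A * emeasure lborel B = (\<integral>\<^sup>+y. (\<integral>\<^sup>+x. ?i A x * ?i B y \<partial>N) \<partial>lborel)"
      by (simp add: nn_integral_multc nn_integral_cmult)
    also have "\<dots> = (\<integral>\<^sup>+y. (\<integral>\<^sup>+x. ?i A (y + x) * ?i B y \<partial>N) \<partial>lborel)"
      by (subst N_trans) simp_all
    also have "\<dots> = (\<integral>\<^sup>+x. (\<integral>\<^sup>+y. ?i A (y + x) * ?i B y \<partial>lborel) \<partial>N)"
      by (rule P.Fubini') simp
    also have "\<dots> = (\<integral>\<^sup>+x. (\<integral>\<^sup>+y. ?i A y * ?i B (- x + y) \<partial>lborel) \<partial>N)"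
    proof (rule nn_integral_cong)
      fix x
      show "(\<integral>\<^sup>+y. ?i A (y + x) * ?i B y \<partial>lborel) = (\<integral>\<^sup>+y. ?i A y * ?i B (- x + y) \<partial>lborel)"
        using nn_integral_lborel_translation[of "\<lambda>y. ?i A y * ?i B (- x + y)" x]
        by (simp add: add.commute)
    qed
    also have "\<dots> = (\<integral>\<^sup>+y. (\<integral>\<^sup>+x. ?i A y * ?i B (- x + y) \<partial>N) \<partial>lborel)"
      by (rule P.Fubini'[symmetric]) simp
    also have "\<dots> = (\<integral>\<^sup>+y. ?i A y * (\<integral>\<^sup>+x. ?i B (- y + x) \<partial>N) \<partial>lborel)"
    proof (rule nn_integral_cong)
      fix y
      have "?i B (- x + y) = ?i B (- y + x)" for x
        using minus[of "y - x"] by (simp add: indicator_def)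
      then show "(\<integral>\<^sup>+x. ?i A y * ?i B (- x + y) \<partial>N) = ?i A y * (\<integral>\<^sup>+x. ?i B (- y + x) \<partial>N)"
        by (simp add: nn_integral_cmult)
    qed
    also have "\<dots> = (\<integral>\<^sup>+y. ?i A y * emeasure N B \<partial>lborel)"
      by (subst N_trans) simp_all
    also have "\<dots> = emeasure lborel A * emeasure lborel B"
      by (simp add: nn_integral_multc NB)
    finally show ?thesis
      using B_nz B_fin by (simp add: ennreal_mult_cancel_left mult.commute[of _ "emeasure lborel B"])
  qed
  then show ?thesis
    unfolding N_def[symmetric] by (intro measure_eqI) simp_all
qed

section \<open>Integration of continuous functions over the sphere\<close>

interpretation sphere: prob_space "sphere_measure :: 'a::euclidean_space measure"
  by (rule prob_space_sphere_measure)

lemma integrable_sphere_measure: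
  fixes g :: "'a::euclidean_space \<Rightarrow> complex"
  assumes "continuous_on (sphere 0 1) g"
  shows "integrable sphere_measure g"
proof -
  have "g \<in> borel_measurable sphere_measure"
    using borel_measurable_continuous_on_restrict[OF assms]
    by (simp add: measurable_cong_sets[OF sets_sphere_measure refl])
  moreover have "compact (g ` sphere 0 1)"
    by (intro compact_continuous_image assms compact_sphere)
  then obtain K where "\<forall>x\<in>sphere 0 1. cmod (g x) \<le> K"
    by (meson bounded_iff compact_imp_bounded image_eqI)
  ultimately show ?thesis
    by (intro sphere.integrable_const_bound[where B=K])
       (auto simp: space_sphere_measure intro!: AE_I2)
qed

text \<open>A linear isometry commutes with the radial projection and preserves the uniform
  distribution on the ball, whose image is the surface measure.\<close>

lemma integral_sphere_measure_orthogonal_transformation: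
  fixes U :: "'a::euclidean_space \<Rightarrow> 'a" and g :: "'a \<Rightarrow> complex"
  assumes U: "orthogonal_transformation U" and g: "continuous_on UNIV g"
  shows "(\<integral>x. g (U x) \<partial>sphere_measure) = (\<integral>x. g x \<partial>sphere_measure)"
proof -
  define u where "u = uniform_measure lborel (ball (0::'a) 1)"
  have lin: "linear U" using U by (simp add: orthogonal_transformation)
  then have Uc: "continuous_on UNIV U"
    by (intro linear_continuous_on linear_conv_bounded_linear[THEN iffD1])
  have [measurable]: "U \<in> borel_measurable borel"
    by (intro borel_measurable_continuous_onI Uc)
  have nU: "norm (U x) = norm x" for x using U by (simp add: orthogonal_transformation)
  have [simp, measurable_cong]: "sets u = sets borel" by (simp add: u_def)
  have [measurable]: "sphere 0 1 \<in> sets (borel :: 'a measure)"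
    by (intro borel_closed closed_sphere)
  \<comment> \<open>The indicator discards the origin alone: the projection sends 0 to 0 and every
    other point to the sphere.\<close>
  have sphere_integral: "(\<integral>x. h x \<partial>sphere_measure) =
      (\<integral>x. indicator (sphere 0 1) (x /\<^sub>R norm x) *\<^sub>R h (x /\<^sub>R norm x) \<partial>u)"
    if "continuous_on UNIV h" for h :: "'a \<Rightarrow> complex"
  proof -
    have [measurable]: "h \<in> borel_measurable borel"
      by (intro borel_measurable_continuous_onI that)
    show ?thesis
      unfolding sphere_measure_def u_def[symmetric]
      by (subst integral_restrict_space, simp, subst integral_distr) auto
  qed
  have distr_u: "distr u borel U = u"
  proof (rule measure_eqI)
    fix A assume "A \<in> sets (distr u borel U)"
    then have [measurable]: "A \<in> sets borel" by simp
    have "U -` A \<in> sets borel" using measurable_sets[of U borel borel A] by simp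
    moreover have "ball 0 1 \<inter> U -` A = U -` (ball 0 1 \<inter> A)" by (auto simp: nU)
    moreover have "emeasure lborel (U -` (ball 0 1 \<inter> A)) = emeasure (distr lborel borel U) (ball 0 1 \<inter> A)"
      by (subst emeasure_distr) auto
    ultimately show "emeasure (distr u borel U) A = emeasure u A"
      by (simp add: emeasure_distr u_def distr_lborel_orthogonal_transformation[OF U])
  qed simp
  have [measurable]: "g \<in> borel_measurable borel"
    by (intro borel_measurable_continuous_onI g)
  have "(\<integral>x. g (U x) \<partial>sphere_measure) =
      (\<integral>x. indicator (sphere 0 1) (U x /\<^sub>R norm (U x)) *\<^sub>R g (U x /\<^sub>R norm (U x)) \<partial>u)"
    using continuous_on_compose2[OF g Uc]
    by (subst sphere_integral) (auto simp: nU linear_scale[OF lin] indicator_def)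
  also have "\<dots> = (\<integral>x. indicator (sphere 0 1) (x /\<^sub>R norm x) *\<^sub>R g (x /\<^sub>R norm x) \<partial>distr u borel U)"
    by (subst integral_distr) auto
  finally show ?thesis by (simp add: distr_u sphere_integral[OF g])
qed

subsection \<open>Positive semidefinite square roots and matrix norms\<close>

lemma hinner_add_left: "hinner (x + y) z = hinner x z + hinner y z"
  by (simp add: hinner_def algebra_simps sum.distrib)

lemma hinner_add_right: "hinner x (y + z) = hinner x y + hinner x z"
  by (simp add: hinner_def algebra_simps sum.distrib)

lemma hinner_diff_left: "hinner (x - y) z = hinner x z - hinner y z"
  by (simp add: hinner_def algebra_simps sum_subtractf)

lemma hinner_diff_right: "hinner x (y - z) = hinner x y - hinner x z"
  by (simp add: hinner_def algebra_simps sum_subtractf)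

lemma hinner_scale_left: "hinner (c *s x) y = c * hinner x y"
  by (simp add: hinner_def sum_distrib_left mult_ac)

lemma hinner_scale_right: "hinner x (c *s y) = cnj c * hinner x y"
  by (simp add: hinner_def sum_distrib_left mult_ac)

lemma hinner_zero_left [simp]: "hinner 0 x = 0"
  by (simp add: hinner_def)

lemma hinner_sum_left: "hinner (\<Sum>i\<in>I. f i) y = (\<Sum>i\<in>I. hinner (f i) y)"
  by (induction I rule: infinite_finite_induct) (simp_all add: hinner_add_left)

lemma cnj_hinner: "cnj (hinner x y) = hinner y x"
  by (simp add: hinner_def mult.commute)

lemma Re_hinner: "Re (hinner x y) = x \<bullet> y"
  by (simp add: hinner_def inner_vec_def inner_complex_def)

lemma hinner_self: "hinner x x = complex_of_real ((norm x)\<^sup>2)"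
  using cnj_hinner[of x x] Re_hinner[of x x] by (simp add: complex_eq_iff power2_norm_eq_inner)

lemmas hinner_simps = hinner_add_left hinner_add_right hinner_diff_left hinner_diff_right
  hinner_scale_left hinner_scale_right

lemma continuous_on_hinner [continuous_intros]:
  assumes "continuous_on S f" "continuous_on S g"
  shows "continuous_on S (\<lambda>x. hinner (f x) (g x))"
  unfolding hinner_def by (intro continuous_intros assms continuous_on_component)

lemma continuous_on_matrix_vector_mult [continuous_intros]:
  fixes A :: "complex ^ 'n ^ 'm"
  assumes "continuous_on S f"
  shows "continuous_on S (\<lambda>x. A *v f x)"
  unfolding matrix_vector_mult_def
  by (intro continuous_on_vec_lambda continuous_intros assms continuous_on_component)

lemma hinner_ctranspose: "hinner (A *v x) y = hinner x (ctranspose A *v y)"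
proof -
  have "hinner (A *v x) y = (\<Sum>i\<in>UNIV. \<Sum>j\<in>UNIV. A $ i $ j * x $ j * cnj (y $ i))"
    by (simp add: hinner_def matrix_vector_mult_def sum_distrib_right)
  also have "\<dots> = (\<Sum>j\<in>UNIV. \<Sum>i\<in>UNIV. A $ i $ j * x $ j * cnj (y $ i))"
    by (rule sum.swap)
  also have "\<dots> = hinner x (ctranspose A *v y)"
    by (simp add: hinner_def matrix_vector_mult_def ctranspose_def sum_distrib_left mult_ac)
  finally show ?thesis .
qed

lemma matrix_vector_mult_vector_scale: "(A :: complex ^ 'n ^ 'm) *v (c *s x) = c *s (A *v x)"
  by (simp add: vec_eq_iff matrix_vector_mult_def sum_distrib_left mult_ac)

lemma matrix_vector_mult_linear_combination:
  "(A :: complex ^ 'n ^ 'm) *v (\<Sum>i\<in>I. c i *s f i) = (\<Sum>i\<in>I. c i *s (A *v f i))"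
  by (induction I rule: infinite_finite_induct)
     (simp_all add: matrix_vector_right_distrib matrix_vector_mult_vector_scale)

section \<open>Spectral theorem for Hermitian matrices\<close>

lemma of_real_vector_scale: "complex_of_real r *s x = r *\<^sub>R x"
  by (simp add: vec_eq_iff scaleR_conv_of_real[where 'a=complex])

text \<open>For small \<open>t\<close> the linear term dominates, so a nonzero \<open>a\<close>
  would force a sign change. This is the first-order condition in the variational arguments
  below.\<close>

lemma nonneg_quadratic_linear_coeff_zero:
  fixes a b :: real
  assumes "\<And>t. 0 \<le> 2 * t * a + t\<^sup>2 * b"
  shows "a = 0"
proof (rule ccontr)
  assume a: "a \<noteq> 0"
  \<comment> \<open>\<open>c\<close> is positive and exceeds \<open>b\<close>, so at
    \<open>t = - a / c\<close> the polynomial takes the negative value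
    \<open>- (a\<^sup>2 / c) * (2 - b / c)\<close>.\<close>
  define c where "c = \<bar>b\<bar> + 1"
  have c: "c > 0" "b < c" by (auto simp: c_def)
  have "2 * (- a / c) * a + (- a / c)\<^sup>2 * b = - (a\<^sup>2 / c) * (2 - b / c)"
    using c by (simp add: field_simps power2_eq_square)
  moreover have "a\<^sup>2 / c > 0" "2 - b / c > 0" using a c by (auto simp: field_simps)
  ultimately show False using assms[of "- a / c"] by (smt (verit) mult_pos_pos mult_minus_left)
qed

text \<open>An eigenvector is obtained by maximizing the Rayleigh quotient on the unit sphere of \<open>S\<close>.\<close>

lemma hermitian_eigenvector_in_invariant_subspace:
  fixes H :: "complex ^ 'n ^ 'n"
  assumes H: "ctranspose H = H"
    and S: "closed S" "\<And>x y. x \<in> S \<Longrightarrow> y \<in> S \<Longrightarrow> x + y \<in> S" "\<And>c x. x \<in> S \<Longrightarrow> c *s x \<in> S"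
    and inv: "\<And>x. x \<in> S \<Longrightarrow> H *v x \<in> S"
    and nz: "x0 \<in> S" "x0 \<noteq> 0"
  obtains v l where "v \<in> S" "norm v = 1" "H *v v = complex_of_real l *s v"
proof -
  note cs = of_real_vector_scale
  have "continuous_on (S \<inter> sphere 0 1) (\<lambda>x. Re (hinner (H *v x) x))"
    by (intro continuous_intros)
  moreover have "compact (S \<inter> sphere 0 1)" using S(1) by (intro closed_Int_compact) auto
  moreover have "x0 /\<^sub>R norm x0 \<in> S \<inter> sphere 0 1"
    using S(3)[OF nz(1), of "complex_of_real (inverse (norm x0))"] nz by (simp add: cs del: of_real_inverse)
  then have "S \<inter> sphere 0 1 \<noteq> {}" by blast
  ultimately obtain v where v: "v \<in> S" "norm v = 1"
    and max: "\<And>x. x \<in> S \<Longrightarrow> norm x = 1 \<Longrightarrow> Re (hinner (H *v x) x) \<le> Re (hinner (H *v v) v)"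
    using continuous_attains_sup[of "S \<inter> sphere 0 1" "\<lambda>x. Re (hinner (H *v x) x)"]
    by (metis IntE IntI mem_sphere_0)
  define m where "m = Re (hinner (H *v v) v)"
  \<comment> \<open>By homogeneity, maximality of \<open>m\<close> on unit vectors makes
    \<open>Q\<close> nonnegative on all of \<open>S\<close>. Since \<open>Q v = 0\<close>, the
    vector \<open>v\<close> minimizes \<open>Q\<close>.\<close>
  define Q where "Q = (\<lambda>x. m * (norm x)\<^sup>2 - Re (hinner (H *v x) x))"
  have Q_nonneg: "0 \<le> Q x" if "x \<in> S" for x
  proof (cases "x = 0")
    case False
    define y where "y = x /\<^sub>R norm x"
    have y: "y \<in> S" "norm y = 1"
      using S(3)[OF that, of "complex_of_real (inverse (norm x))"] False by (simp_all add: y_def cs del: of_real_inverse)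
    have x: "x = complex_of_real (norm x) *s y" using False by (simp add: y_def cs)
    have "Re (hinner (H *v x) x) = (norm x)\<^sup>2 * Re (hinner (H *v y) y)"
      by (subst x, subst (2) x) (simp add: matrix_vector_mult_vector_scale hinner_simps power2_eq_square)
    then show ?thesis using max[OF y] by (simp add: Q_def m_def mult.commute mult_right_mono)
  qed (simp add: Q_def)
  \<comment> \<open>The residual \<open>w\<close> stays in \<open>S\<close> by invariance. Moving
    from \<open>v\<close> along \<open>w\<close> changes \<open>Q\<close> to first order by
    \<open>2 * t * (norm w)\<^sup>2\<close>, so minimality forces \<open>w = 0\<close>.\<close>
  define w where "w = complex_of_real m *s v - H *v v"
  have w: "w \<in> S" using S(2)[OF S(3)[OF v(1), of m] S(3)[OF inv[OF v(1)], of "-1"]]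
    by (simp add: w_def)
  have "0 \<le> 2 * t * (norm w)\<^sup>2 + t\<^sup>2 * Q w" for t
  proof -
    have Q: "Q (v + t *\<^sub>R w) = 2 * t * (norm w)\<^sup>2 + t\<^sup>2 * Q w"
    proof -
      have e1: "(norm (v + t *\<^sub>R w))\<^sup>2 = 1 + 2 * t * (v \<bullet> w) + t\<^sup>2 * (norm w)\<^sup>2"
        using v(2) unfolding power2_norm_eq_inner power2_eq_square[of t]
        by (simp add: inner_simps algebra_simps inner_commute norm_eq_1)
      have "hinner (H *v w) v = cnj (hinner (H *v v) w)"
        using hinner_ctranspose[of H w v] by (simp add: H cnj_hinner)
      then have e2: "Re (hinner (H *v (v + t *\<^sub>R w)) (v + t *\<^sub>R w))
          = m + 2 * t * ((H *v v) \<bullet> w) + t\<^sup>2 * Re (hinner (H *v w) w)"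
        by (simp add: m_def matrix_vector_right_distrib matrix_vector_mult_vector_scale hinner_simps
            algebra_simps power2_eq_square flip: cs Re_hinner)
      have "(norm w)\<^sup>2 = m * (v \<bullet> w) - (H *v v) \<bullet> w"
        unfolding power2_norm_eq_inner by (subst (1) w_def) (simp add: inner_diff_left cs)
      then have e3: "(H *v v) \<bullet> w = m * (v \<bullet> w) - (norm w)\<^sup>2" by simp
      show ?thesis unfolding Q_def e1 e2 e3 by (simp add: algebra_simps)
    qed
    have "v + t *\<^sub>R w \<in> S" using S(2)[OF v(1) S(3)[OF w, of t]] by (simp add: cs)
    from Q_nonneg[OF this] show ?thesis unfolding Q .
  qed
  then have "(norm w)\<^sup>2 = 0" by (rule nonneg_quadratic_linear_coeff_zero)
  then have "H *v v = complex_of_real m *s v" by (simp add: w_def)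
  with v show ?thesis by (rule that)
qed

text \<open>An orthonormal family of eigenvectors of maximal cardinality spans: its orthogonal
  complement is closed and invariant under \<open>H\<close>, so if nonzero it would contain one more
  eigenvector.\<close>

lemma hermitian_orthonormal_eigenbasis:
  fixes H :: "complex ^ 'n ^ 'n"
  assumes H: "ctranspose H = H"
  obtains V and ev :: "complex ^ 'n \<Rightarrow> real"
  where "finite V" "\<And>v. v \<in> V \<Longrightarrow> H *v v = complex_of_real (ev v) *s v"
    "\<And>v w. v \<in> V \<Longrightarrow> w \<in> V \<Longrightarrow> hinner v w = (if v = w then 1 else 0)"
    "\<And>x. x = (\<Sum>v\<in>V. hinner x v *s v)"
proof -
  define P where "P = (\<lambda>V. (\<forall>v\<in>V. \<exists>l::real. H *v v = complex_of_real l *s v) \<and>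
    (\<forall>v\<in>V. \<forall>w\<in>V. hinner v w = (if v = w then 1 else 0)))"
  \<comment> \<open>Complex orthonormality implies real orthogonality, so the real dimension bounds
    the cardinality and a maximal family exists.\<close>
  have fin: "finite V \<and> card V \<le> DIM(complex ^ 'n)" if "P V" for V
  proof -
    have "pairwise orthogonal V" "0 \<notin> V"
      using that by (auto simp: P_def pairwise_def orthogonal_def simp flip: Re_hinner)
        (metis hinner_zero_left zero_neq_one)
    then have "independent V" by (rule pairwise_orthogonal_independent)
    then show ?thesis using independent_bound by blast
  qed
  have "P {}" by (simp add: P_def)
  moreover have "\<forall>V. P V \<longrightarrow> card V < Suc (DIM(complex ^ 'n))" using fin by force
  ultimately obtain V where V: "P V" and max: "\<And>W. P W \<Longrightarrow> card W \<le> card V"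
    using ex_has_greatest_nat[of P "{}" card] by blast
  have finV: "finite V" using fin[OF V] by simp
  have ortho: "hinner v w = (if v = w then 1 else 0)" if "v \<in> V" "w \<in> V" for v w
    using V that by (auto simp: P_def)
  define ev where "ev = (\<lambda>v. SOME l::real. H *v v = complex_of_real l *s v)"
  have ev: "H *v v = complex_of_real (ev v) *s v" if "v \<in> V" for v
    using V that unfolding P_def ev_def by (metis (mono_tags, lifting) someI_ex)
  define S where "S = {x. \<forall>v\<in>V. hinner x v = 0}"
  have S0: "x = 0" if "x \<in> S" for x
  proof (rule ccontr)
    assume "x \<noteq> 0"
    have cl: "closed S"
      unfolding S_def Ball_def
      by (intro closed_Collect_all closed_Collect_imp closed_Collect_eq continuous_intros) simp
    have iv: "H *v x \<in> S" if "x \<in> S" for x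
      using that ev by (auto simp: S_def hinner_ctranspose[of H] H hinner_simps)
    have add: "x + y \<in> S" if "x \<in> S" "y \<in> S" for x y
      using that by (auto simp: S_def hinner_simps)
    have scale: "c *s x \<in> S" if "x \<in> S" for x c
      using that by (auto simp: S_def hinner_simps)
    obtain u l where u: "u \<in> S" "norm u = 1" "H *v u = complex_of_real l *s u"
      by (rule hermitian_eigenvector_in_invariant_subspace
          [OF H cl add scale iv \<open>x \<in> S\<close> \<open>x \<noteq> 0\<close>])
    have uV: "u \<notin> V" using u ortho[of u u] by (auto simp: S_def)
    have "hinner v u = 0" if "v \<in> V" for v
      using u(1) that cnj_hinner[of u v] by (auto simp: S_def)
    moreover have "hinner u u = 1" using u(2) by (simp add: hinner_self)
    ultimately have "P (insert u V)"
      using V u(1,3) uV unfolding P_def S_def by auto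
    from max[OF this] show False using uV finV by simp
  qed
  have "x = (\<Sum>v\<in>V. hinner x v *s v)" for x
  proof -
    have "x - (\<Sum>v\<in>V. hinner x v *s v) \<in> S"
      using finV by (auto simp: S_def hinner_diff_left hinner_sum_left hinner_scale_left ortho
          if_distrib cong: if_cong)
    from S0[OF this] show ?thesis by simp
  qed
  with finV ev ortho show ?thesis by (rule that)
qed

section \<open>Existence and uniqueness of positive semidefinite square roots\<close>

lemma psd_sqrt_exists:
  fixes P :: "complex ^ 'n ^ 'n"
  assumes P: "psd P"
  shows "\<exists>B. psd B \<and> B ** B = P"
proof -
  have H: "ctranspose P = P" using P by (simp add: psd_def)
  obtain V and ev :: "complex ^ 'n \<Rightarrow> real" where V: "finite V"
    and ev: "\<And>v. v \<in> V \<Longrightarrow> P *v v = complex_of_real (ev v) *s v"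
    and ortho: "\<And>v w. v \<in> V \<Longrightarrow> w \<in> V \<Longrightarrow> hinner v w = (if v = w then 1 else 0)"
    and expand: "\<And>x. x = (\<Sum>v\<in>V. hinner x v *s v)"
    by (rule hermitian_orthonormal_eigenbasis[OF H]) (rule that)
  have ev_nonneg: "0 \<le> ev v" if "v \<in> V" for v
  proof -
    have "0 \<le> Re (hinner (P *v v) v)" using P by (simp add: psd_def)
    then show ?thesis using that by (simp add: ev hinner_simps ortho)
  qed
  \<comment> \<open>This is the spectral sum of the rank-one projections \<open>v v\<^sup>*\<close>
    weighted by \<open>sqrt (ev v)\<close>, so it scales each eigenvector by the root of its
    eigenvalue.\<close>
  define B :: "complex ^ 'n ^ 'n" where
    "B = (\<chi> i j. \<Sum>v\<in>V. complex_of_real (sqrt (ev v)) * v $ i * cnj (v $ j))"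
  have B: "B *v x = (\<Sum>v\<in>V. (complex_of_real (sqrt (ev v)) * hinner x v) *s v)" for x
  proof -
    have "(B *v x) $ i = (\<Sum>v\<in>V. (complex_of_real (sqrt (ev v)) * hinner x v) *s v) $ i" for i
    proof -
      have "(B *v x) $ i = (\<Sum>j\<in>UNIV. \<Sum>v\<in>V. complex_of_real (sqrt (ev v)) * v $ i * cnj (v $ j) * x $ j)"
        by (simp add: B_def matrix_vector_mult_def sum_distrib_right)
      also have "\<dots> = (\<Sum>v\<in>V. \<Sum>j\<in>UNIV. complex_of_real (sqrt (ev v)) * v $ i * cnj (v $ j) * x $ j)"
        by (rule sum.swap)
      finally show ?thesis by (simp add: hinner_def sum_distrib_left sum_distrib_right mult_ac)
    qed
    then show ?thesis by (simp add: vec_eq_iff)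
  qed
  have "ctranspose B = B"
    by (simp add: vec_eq_iff B_def ctranspose_def mult_ac)
  moreover have "0 \<le> Re (hinner (B *v x) x)" for x
  proof -
    have "hinner (B *v x) x = (\<Sum>v\<in>V. complex_of_real (sqrt (ev v)) * (hinner x v * cnj (hinner x v)))"
      by (simp add: B hinner_sum_left hinner_scale_left cnj_hinner mult_ac)
    also have "Re \<dots> = (\<Sum>v\<in>V. sqrt (ev v) * (cmod (hinner x v))\<^sup>2)"
      by (simp add: complex_mult_cnj cmod_power2)
    also have "\<dots> \<ge> 0" by (intro sum_nonneg mult_nonneg_nonneg) (auto simp: ev_nonneg)
    finally show ?thesis .
  qed
  ultimately have "psd B" by (simp add: psd_def)
  moreover have "B ** B = P"
  proof -
    have Bv: "B *v v = complex_of_real (sqrt (ev v)) *s v" if "v \<in> V" for v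
      using V that by (simp add: B ortho if_distrib if_distribR sum.delta cong: if_cong sum.cong)
    have "(B ** B) *v x = P *v x" for x
    proof -
      have "(B ** B) *v x = (B ** B) *v (\<Sum>v\<in>V. hinner x v *s v)"
        by (rule arg_cong[OF expand])
      also have "\<dots> = (\<Sum>v\<in>V. hinner x v *s ((B ** B) *v v))"
        by (simp only: matrix_vector_mult_linear_combination)
      also have "\<dots> = (\<Sum>v\<in>V. hinner x v *s (P *v v))"
      proof (rule sum.cong)
        fix v assume v: "v \<in> V"
        have "sqrt (ev v) * sqrt (ev v) = ev v" using ev_nonneg[OF v] by simp
        then have "(B ** B) *v v = P *v v"
          using v by (simp add: Bv ev matrix_vector_mult_vector_scale flip: matrix_vector_mul_assoc of_real_mult)
        then show "hinner x v *s ((B ** B) *v v) = hinner x v *s (P *v v)" by simp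
      qed simp
      also have "\<dots> = P *v (\<Sum>v\<in>V. hinner x v *s v)"
        by (simp only: matrix_vector_mult_linear_combination)
      also have "\<dots> = P *v x" by (rule arg_cong[OF expand[symmetric]])
      finally show ?thesis .
    qed
    then show ?thesis by (simp add: matrix_eq)
  qed
  ultimately show ?thesis by blast
qed

text \<open>A zero of a nonnegative form is a minimum, so the first variation vanishes there. In the
  direction \<open>w = B *v x\<close> that variation is \<open>2 * (norm w)\<^sup>2\<close>.\<close>

lemma psd_mult_eq_0:
  assumes B: "psd B" and x: "hinner (B *v x) x = 0"
  shows "B *v x = 0"
proof -
  have sym: "hinner (B *v y) z = hinner y (B *v z)" for y z
    using B hinner_ctranspose[of B] by (simp add: psd_def)
  define w where "w = B *v x"
  have "0 \<le> 2 * t * (norm w)\<^sup>2 + t\<^sup>2 * Re (hinner (B *v w) w)" for t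
  proof -
    have "0 \<le> Re (hinner (B *v (x + complex_of_real t *s w)) (x + complex_of_real t *s w))"
      using B by (simp add: psd_def)
    also have "\<dots> = 2 * t * (norm w)\<^sup>2 + t\<^sup>2 * Re (hinner (B *v w) w)"
      using x sym[of w x]
      by (simp add: matrix_vector_right_distrib matrix_vector_mult_vector_scale hinner_simps
          hinner_self power2_eq_square algebra_simps flip: w_def)
    finally show ?thesis .
  qed
  then have "(norm w)\<^sup>2 = 0" by (rule nonneg_quadratic_linear_coeff_zero)
  then show ?thesis by (simp add: w_def)
qed

text \<open>\<open>D = B - C\<close> satisfies \<open>B D + D C = 0\<close>, so an eigenvector of \<open>D\<close> with nonzero eigenvalue
  would be annihilated by both \<open>B\<close> and \<open>C\<close>, hence by \<open>D\<close>.\<close>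

lemma psd_sqrt_unique:
  fixes B C :: "complex ^ 'n ^ 'n"
  assumes B: "psd B" and C: "psd C" and eq: "B ** B = C ** C"
  shows "B = C"
proof -
  define D where "D = B - C"
  have H: "ctranspose D = D"
    using B C by (simp add: D_def psd_def ctranspose_def vec_eq_iff)
  obtain V and ev :: "complex ^ 'n \<Rightarrow> real" where V: "finite V"
    and ev: "\<And>v. v \<in> V \<Longrightarrow> D *v v = complex_of_real (ev v) *s v"
    and ortho: "\<And>v w. v \<in> V \<Longrightarrow> w \<in> V \<Longrightarrow> hinner v w = (if v = w then 1 else 0)"
    and expand: "\<And>x. x = (\<Sum>v\<in>V. hinner x v *s v)"
    by (rule hermitian_orthonormal_eigenbasis[OF H]) (rule that)
  have Dv: "D *v v = 0" if v: "v \<in> V" for v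
  proof (cases "ev v = 0")
    case True then show ?thesis using ev[OF v] by simp
  next
    case False
    have "B *v (B *v v) = C *v (C *v v)"
      using eq by (simp add: matrix_vector_mul_assoc)
    then have "B *v (D *v v) + D *v (C *v v) = 0"
      by (simp add: D_def matrix_vector_mult_diff_rdistrib matrix_vector_mult_diff_distrib)
    then have "hinner (B *v (D *v v)) v + hinner (D *v (C *v v)) v = 0"
      by (simp flip: hinner_add_left)
    \<comment> \<open>As \<open>D\<close> is Hermitian and \<open>v\<close> an eigenvector with real
      eigenvalue, both terms acquire the same factor \<open>ev v\<close>, which can be
      cancelled.\<close>
    then have "complex_of_real (ev v) * (hinner (B *v v) v + hinner (C *v v) v) = 0"
      using hinner_ctranspose[of D "C *v v" v]
      by (simp add: H ev[OF v] hinner_simps matrix_vector_mult_vector_scale ring_distribs)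
    then have *: "hinner (B *v v) v + hinner (C *v v) v = 0" using False by simp
    \<comment> \<open>Both forms are real and nonnegative, so their vanishing sum makes each of them
      vanish.\<close>
    have real: "hinner (M *v v) v = complex_of_real (Re (hinner (M *v v) v))" if "psd M" for M
    proof -
      have "cnj (hinner (M *v v) v) = hinner v (M *v v)" by (rule cnj_hinner)
      also have "\<dots> = hinner (M *v v) v"
        using that hinner_ctranspose[of M v v] by (simp only: psd_def)
      finally show ?thesis by (simp add: complex_eq_iff)
    qed
    have "0 \<le> Re (hinner (B *v v) v)" "0 \<le> Re (hinner (C *v v) v)"
      using B C by (auto simp: psd_def)
    moreover have "Re (hinner (B *v v) v) + Re (hinner (C *v v) v) = 0"
      using arg_cong[OF *, of Re] by simp
    ultimately have "Re (hinner (B *v v) v) = 0" "Re (hinner (C *v v) v) = 0"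
      by linarith+
    then have "hinner (B *v v) v = 0" "hinner (C *v v) v = 0"
      by (subst real[OF B], simp, subst real[OF C], simp)
    then show ?thesis
      using psd_mult_eq_0[OF B, of v] psd_mult_eq_0[OF C, of v] by (simp add: D_def matrix_vector_mult_diff_rdistrib)
  qed
  have "D *v x = 0" for x
  proof -
    have "D *v x = D *v (\<Sum>v\<in>V. hinner x v *s v)" by (rule arg_cong[OF expand])
    also have "\<dots> = (\<Sum>v\<in>V. hinner x v *s (D *v v))"
      by (simp only: matrix_vector_mult_linear_combination)
    finally show ?thesis by (simp add: Dv)
  qed
  then have "B *v x = C *v x" for x by (simp add: D_def matrix_vector_mult_diff_rdistrib)
  then show ?thesis by (simp add: matrix_eq)
qed

section \<open>Frobenius and Schatten norms as traces\<close>

lemma ctranspose_mult: "ctranspose (A ** B) = ctranspose B ** ctranspose A"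
  by (simp add: vec_eq_iff ctranspose_def matrix_matrix_mult_def mult.commute)

lemma ctranspose_ctranspose [simp]: "ctranspose (ctranspose A) = A"
  by (simp add: vec_eq_iff ctranspose_def)

text \<open>Existence and uniqueness of the root give the definite description in
  \<open>psd_sqrt\<close> its meaning. It applies because the form of
  \<open>ctranspose A ** A\<close> at \<open>x\<close> is the squared norm of
  \<open>A *v x\<close>.\<close>

lemma matrix_abs_square: "matrix_abs A ** matrix_abs A = ctranspose A ** A"
proof -
  have "psd (ctranspose A ** A)"
    by (simp add: psd_def ctranspose_mult hinner_ctranspose hinner_self flip: matrix_vector_mul_assoc)
  from psd_sqrt_exists[OF this] obtain B where B: "psd B" "B ** B = ctranspose A ** A" by (elim exE conjE)
  then have "C = B" if "psd C \<and> C ** C = ctranspose A ** A" for C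
    using that by (auto intro!: psd_sqrt_unique[of C B])
  with B have "psd (psd_sqrt (ctranspose A ** A)) \<and>
      psd_sqrt (ctranspose A ** A) ** psd_sqrt (ctranspose A ** A) = ctranspose A ** A"
    unfolding psd_sqrt_def
    by (intro theI[of "\<lambda>C. psd C \<and> C ** C = ctranspose A ** A" B]) blast+
  then show ?thesis by (simp add: matrix_abs_def)
qed

lemma frobenius_norm_square: "complex_of_real ((frobenius_norm A)\<^sup>2) = trace (A ** ctranspose A)"
  by (simp add: frobenius_norm_def trace_def matrix_matrix_mult_def ctranspose_def sum_nonneg
      complex_mult_cnj cmod_power2)

text \<open>By cyclicity the trace is the squared Frobenius norm of
  \<open>ctranspose A ** A\<close>, a nonnegative real, so taking the real part and the fourth root
  loses nothing.\<close>

lemma schatten4_norm_power4: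
  "complex_of_real ((schatten4_norm A) ^ 4) = trace (A ** ctranspose A ** A ** ctranspose A)"
proof -
  let ?P = "ctranspose A ** A"
  have "trace (A ** ctranspose A ** A ** ctranspose A) = trace (?P ** ?P)"
    using trace_mul_sym[of A "ctranspose A ** A ** ctranspose A"] by (simp add: matrix_mul_assoc)
  also have "\<dots> = complex_of_real ((frobenius_norm ?P)\<^sup>2)"
    by (simp add: frobenius_norm_square ctranspose_mult del: of_real_power)
  finally have 1: "trace (?P ** ?P) = complex_of_real ((frobenius_norm ?P)\<^sup>2)"
    and 2: "trace (A ** ctranspose A ** A ** ctranspose A) = complex_of_real ((frobenius_norm ?P)\<^sup>2)"
    by (simp_all add: frobenius_norm_square ctranspose_mult del: of_real_power)
  have "matrix_abs A ** matrix_abs A ** matrix_abs A ** matrix_abs A = ?P ** ?P"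
    by (metis matrix_abs_square matrix_mul_assoc)
  then have "schatten4_norm A = ((frobenius_norm ?P)\<^sup>2) powr (1 / 4)"
    by (simp add: schatten4_norm_def 1 flip: of_real_power)
  moreover have "(x powr (1 / 4)) ^ 4 = x" if "0 \<le> x" for x :: real
    using that by (cases "x = 0") (simp_all add: powr_power)
  ultimately have "(schatten4_norm A) ^ 4 = (frobenius_norm ?P)\<^sup>2"
    by simp
  then show ?thesis using 2 by simp
qed

subsection \<open>The commutator identity for moments of quadratic forms\<close>

lemma quad_form_mat_1: "quad_form (mat 1) z = complex_of_real ((norm z)\<^sup>2)"
  by (simp add: quad_form_def hinner_self)

lemma continuous_on_quad_form [continuous_intros]:
  assumes "continuous_on S f"
  shows "continuous_on S (\<lambda>x. quad_form A (f x))"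
  unfolding quad_form_def by (intro continuous_intros assms)

lemma cnj_quad_form: "cnj (quad_form A z) = quad_form (ctranspose A) z"
  by (simp add: quad_form_def cnj_hinner hinner_ctranspose[of "ctranspose A"])

text \<open>This is the quadratic form of the commutator \<open>A X - X A\<close> with \<open>X = v w\<^sup>*\<close>.\<close>

definition quad_form_comm :: "complex ^ 'n \<Rightarrow> complex ^ 'n \<Rightarrow> complex ^ 'n ^ 'n \<Rightarrow> complex ^ 'n \<Rightarrow> complex" where
  "quad_form_comm v w A z = hinner (A *v v) z * hinner z w - hinner v z * hinner (A *v z) w"

lemma continuous_on_quad_form_comm [continuous_intros]:
  "continuous_on S (quad_form_comm v w A)"
  unfolding quad_form_comm_def by (intro continuous_intros)

section \<open>Phase rotations and first-order expansions\<close>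

text \<open>This is \<open>exp (i t v v\<^sup>*)\<close> when \<open>v\<close> is a unit vector.\<close>

definition phase_rotation :: "complex ^ 'n \<Rightarrow> real \<Rightarrow> complex ^ 'n \<Rightarrow> complex ^ 'n" where
  "phase_rotation v t z = z + ((cis t - 1) * hinner z v) *s v"

text \<open>The component along the unit vector \<open>v\<close> is multiplied by
  \<open>cis t\<close>, of modulus one, and the orthogonal complement is fixed.\<close>

lemma orthogonal_transformation_phase_rotation:
  assumes v: "norm v = 1"
  shows "orthogonal_transformation (phase_rotation v t)"
proof -
  have "linear (phase_rotation v t)"
    by (rule linearI)
       (simp_all add: phase_rotation_def hinner_simps algebra_simps scaleR_conv_of_real[where 'a=complex] vec_eq_iff
         flip: of_real_vector_scale)
  moreover have "norm (phase_rotation v t z) = norm z" for z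
  proof -
    have vv: "hinner v v = 1" using v by (simp add: hinner_self)
    have cc: "cis t * cis (- t) = 1" by (simp add: cis_mult)
    have "hinner (phase_rotation v t z) (phase_rotation v t z) =
        hinner z z + (cis t * cis (-t) - 1) * (hinner z v * hinner v z)"
      by (simp add: phase_rotation_def hinner_simps vv cnj_hinner cis_cnj algebra_simps)
    then have "complex_of_real ((norm (phase_rotation v t z))\<^sup>2) = complex_of_real ((norm z)\<^sup>2)"
      by (simp add: cc hinner_self)
    then show ?thesis unfolding of_real_eq_iff by (simp add: power2_eq_iff_nonneg)
  qed
  ultimately show ?thesis by (simp add: orthogonal_transformation)
qed

text \<open>\<open>d\<close> is the derivative of \<open>F\<close> in \<open>t\<close> at \<open>0\<close> with a quadratic remainder bounded uniformly on \<open>S\<close>, which is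
  what allows differentiation under the integral.\<close>

definition first_order_on :: "'a set \<Rightarrow> (real \<Rightarrow> 'a \<Rightarrow> complex) \<Rightarrow> ('a \<Rightarrow> complex) \<Rightarrow> ('a \<Rightarrow> complex) \<Rightarrow> bool" where
  "first_order_on S F f d \<longleftrightarrow> (\<exists>K. \<forall>t\<in>{0..1}. \<forall>z\<in>S. cmod (f z) \<le> K \<and> cmod (d z) \<le> K \<and>
     cmod (F t z - f z - of_real t * d z) \<le> K * t\<^sup>2)"

text \<open>Leibniz rule. The quadratic remainder stays uniform because values and derivatives are
  bounded on \<open>S\<close> and \<open>t\<close> is at most 1.\<close>

lemma first_order_on_mult:
  assumes "first_order_on S F f d" "first_order_on S G g e"
  shows "first_order_on S (\<lambda>t z. F t z * G t z) (\<lambda>z. f z * g z) (\<lambda>z. d z * g z + f z * e z)"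
proof -
  obtain K where K: "\<And>t z. t \<in> {0..1} \<Longrightarrow> z \<in> S \<Longrightarrow> cmod (f z) \<le> K \<and> cmod (d z) \<le> K \<and>
     cmod (F t z - f z - of_real t * d z) \<le> K * t\<^sup>2"
    using assms(1) unfolding first_order_on_def by blast
  obtain L where L: "\<And>t z. t \<in> {0..1} \<Longrightarrow> z \<in> S \<Longrightarrow> cmod (g z) \<le> L \<and> cmod (e z) \<le> L \<and>
     cmod (G t z - g z - of_real t * e z) \<le> L * t\<^sup>2"
    using assms(2) unfolding first_order_on_def by blast
  \<comment> \<open>The 6 is 3 + 2 + 1, one summand per remainder term: \<open>r\<close> times the
    value of \<open>G\<close>, the linear part of \<open>F\<close> times \<open>s\<close>, and the
    product of the two derivatives.\<close>
  have "cmod (f z * g z) \<le> 6 * K * L \<and> cmod (d z * g z + f z * e z) \<le> 6 * K * L \<and>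
     cmod (F t z * G t z - f z * g z - of_real t * (d z * g z + f z * e z)) \<le> 6 * K * L * t\<^sup>2"
    if t: "t \<in> {0..1}" and z: "z \<in> S" for t z
  proof -
    note k = K[OF t z] and l = L[OF t z]
    have K0: "0 \<le> K" using k norm_ge_zero[of "f z"] by linarith
    have L0: "0 \<le> L" using l norm_ge_zero[of "g z"] by linarith
    have KL: "0 \<le> K * L" using K0 L0 by simp
    have t2: "0 \<le> t\<^sup>2" "t\<^sup>2 \<le> 1" "0 \<le> t" "t \<le> 1" using t by (auto simp: power_le_one)
    have fg: "cmod (f z * g z) \<le> K * L" and dg: "cmod (d z * g z) \<le> K * L"
      and fe: "cmod (f z * e z) \<le> K * L" and de: "cmod (d z * e z) \<le> K * L"
      using k l K0 by (auto simp: norm_mult intro!: mult_mono)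
    define r where "r = F t z - f z - of_real t * d z"
    define s where "s = G t z - g z - of_real t * e z"
    have r: "cmod r \<le> K * t\<^sup>2" and s: "cmod s \<le> L * t\<^sup>2" using k l by (auto simp: r_def s_def)
    have td: "cmod (f z + of_real t * d z) \<le> 2 * K"
    proof -
      have "cmod (f z + of_real t * d z) \<le> cmod (f z) + t * cmod (d z)"
        using norm_triangle_ineq[of "f z" "of_real t * d z"] t2 by (simp add: norm_mult)
      also have "\<dots> \<le> K + 1 * K" using k t2 by (intro add_mono mult_mono) auto
      finally show ?thesis by simp
    qed
    have te: "cmod (g z + of_real t * e z + s) \<le> 3 * L"
    proof -
      have "cmod (g z + of_real t * e z + s) \<le> cmod (g z) + t * cmod (e z) + cmod s"
        using norm_triangle_ineq[of "g z" "of_real t * e z"] norm_triangle_ineq[of "g z + of_real t * e z" s] t2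
        by (simp add: norm_mult)
      also have "\<dots> \<le> L + 1 * L + L * 1"
        using l t2 s L0 by (intro add_mono mult_mono) (auto intro: order_trans mult_left_le)
      finally show ?thesis by simp
    qed
    have "F t z * G t z - f z * g z - of_real t * (d z * g z + f z * e z) =
      r * (g z + of_real t * e z + s) + (f z + of_real t * d z) * s + of_real (t\<^sup>2) * (d z * e z)"
      by (simp add: r_def s_def algebra_simps power2_eq_square)
    also have "cmod \<dots> \<le> cmod r * cmod (g z + of_real t * e z + s) + cmod (f z + of_real t * d z) * cmod s
        + t\<^sup>2 * cmod (d z * e z)"
      using norm_triangle_ineq[of "r * (g z + of_real t * e z + s) + (f z + of_real t * d z) * s" "of_real (t\<^sup>2) * (d z * e z)"]
        norm_triangle_ineq[of "r * (g z + of_real t * e z + s)" "(f z + of_real t * d z) * s"]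
      by (simp add: norm_mult norm_power)
    also have "\<dots> \<le> (K * t\<^sup>2) * (3 * L) + (2 * K) * (L * t\<^sup>2) + t\<^sup>2 * (K * L)"
      using r s td te de K0 L0 t2 by (intro add_mono mult_mono) auto
    also have "\<dots> = 6 * K * L * t\<^sup>2" by (simp add: algebra_simps)
    finally have "cmod (F t z * G t z - f z * g z - of_real t * (d z * g z + f z * e z)) \<le> 6 * K * L * t\<^sup>2" .
    moreover have "cmod (d z * g z + f z * e z) \<le> K * L + K * L"
      using norm_triangle_ineq[of "d z * g z" "f z * e z"] dg fe by linarith
    ultimately show ?thesis using fg KL by auto
  qed
  then show ?thesis unfolding first_order_on_def by blast
qed

lemma first_order_on_quad_form_phase_rotation:
  assumes v: "norm v = 1"
  shows "first_order_on (sphere 0 1) (\<lambda>t z. quad_form A (phase_rotation v t z)) (quad_form A)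
    (\<lambda>z. \<i> * quad_form_comm v v A z)"
proof -
  have bdd: "\<exists>K. \<forall>z\<in>sphere 0 1. cmod (g z) \<le> K"
    if "continuous_on (sphere 0 1) g" for g :: "complex ^ 'n \<Rightarrow> complex"
    using compact_imp_bounded[OF compact_continuous_image[OF that compact_sphere]]
    by (auto simp: bounded_iff)
  \<comment> \<open>With \<open>s = cis t - 1\<close>, the rotated form is its value at
    \<open>z\<close> plus \<open>s * p z + cnj s * q z + s * cnj s * r z\<close>. The difference of
    \<open>p\<close> and \<open>q\<close> is the commutator form.\<close>
  define p where "p = (\<lambda>z. hinner (A *v v) z * hinner z v)"
  define q where "q = (\<lambda>z. hinner v z * hinner (A *v z) v)"
  define r where "r = (\<lambda>z. hinner z v * hinner v z * hinner (A *v v) v)"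
  have cont: "continuous_on (sphere 0 1) p" "continuous_on (sphere 0 1) q" "continuous_on (sphere 0 1) r"
    unfolding p_def q_def r_def by (intro continuous_intros)+
  obtain P Q R where P: "\<And>z. z \<in> sphere 0 1 \<Longrightarrow> cmod (p z) \<le> P"
    and Q: "\<And>z. z \<in> sphere 0 1 \<Longrightarrow> cmod (q z) \<le> Q"
    and R: "\<And>z. z \<in> sphere 0 1 \<Longrightarrow> cmod (r z) \<le> R"
    using bdd[OF cont(1)] bdd[OF cont(2)] bdd[OF cont(3)] by blast
  have comm: "quad_form_comm v v A z = p z - q z" for z
    by (simp add: quad_form_comm_def p_def q_def)
  obtain F where F: "\<And>z. z \<in> sphere 0 1 \<Longrightarrow> cmod (quad_form A z) \<le> F"
    using bdd[of "quad_form A"] continuous_on_quad_form[OF continuous_on_id] by blast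
  have rest: "cmod (quad_form A (phase_rotation v t z) - quad_form A z - of_real t * (\<i> * quad_form_comm v v A z))
      \<le> (P + Q + R) * t\<^sup>2" if t: "t \<in> {0..1}" and z: "z \<in> sphere 0 1" for t z
  proof -
    \<comment> \<open>\<open>s\<close> is of first order in \<open>t\<close>. Removing its linear
      term leaves \<open>u\<close>, of second order by the Taylor bounds for the
      exponential.\<close>
    define s where "s = cis t - 1"
    define u where "u = s - \<i> * of_real t"
    have cs: "cmod s \<le> t"
      using iexp_approx1[of t 0] t by (simp add: s_def cis_conv_exp)
    have "2 * cmod u \<le> t\<^sup>2"
      using iexp_approx1[of t 1]
      by (simp add: u_def s_def cis_conv_exp algebra_simps power2_eq_square)
    then have cu: "cmod u \<le> t\<^sup>2" using norm_ge_zero[of u] by linarith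
    have "quad_form A (phase_rotation v t z) = quad_form A z + s * p z + cnj s * q z + (s * cnj s) * r z"
      by (simp add: quad_form_def phase_rotation_def p_def q_def r_def matrix_vector_right_distrib
          matrix_vector_mult_vector_scale hinner_simps cnj_hinner algebra_simps flip: s_def)
    then have "quad_form A (phase_rotation v t z) - quad_form A z - of_real t * (\<i> * quad_form_comm v v A z) =
      u * p z + cnj u * q z + (s * cnj s) * r z"
      by (simp add: comm u_def algebra_simps)
    also have "cmod \<dots> \<le> cmod u * cmod (p z) + cmod u * cmod (q z) + (cmod s)\<^sup>2 * cmod (r z)"
      using norm_triangle_ineq[of "u * p z + cnj u * q z" "(s * cnj s) * r z"]
        norm_triangle_ineq[of "u * p z" "cnj u * q z"]
      by (simp add: norm_mult power2_eq_square)
    also have "\<dots> \<le> t\<^sup>2 * P + t\<^sup>2 * Q + t\<^sup>2 * R"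
      using cs cu P[OF z] Q[OF z] R[OF z] by (intro add_mono mult_mono power_mono) auto
    finally show ?thesis by (simp add: algebra_simps)
  qed
  define K where "K = \<bar>F\<bar> + \<bar>P\<bar> + \<bar>Q\<bar> + \<bar>R\<bar>"
  have "cmod (quad_form A z) \<le> K \<and> cmod (\<i> * quad_form_comm v v A z) \<le> K \<and>
    cmod (quad_form A (phase_rotation v t z) - quad_form A z - of_real t * (\<i> * quad_form_comm v v A z)) \<le> K * t\<^sup>2"
    if t: "t \<in> {0..1}" and z: "z \<in> sphere 0 1" for t z
  proof -
    have "(P + Q + R) * t\<^sup>2 \<le> K * t\<^sup>2" by (intro mult_right_mono) (auto simp: K_def)
    moreover have "cmod (p z - q z) \<le> P + Q"
      using norm_triangle_ineq4[of "p z" "q z"] P[OF z] Q[OF z] by linarith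
    ultimately show ?thesis using F[OF z] rest[OF t z] by (auto simp: norm_mult comm K_def)
  qed
  then show ?thesis unfolding first_order_on_def by blast
qed

section \<open>Vanishing first variation of the moments\<close>

lemma first_order_on_sphere_integral_zero:
  assumes fo: "first_order_on (sphere (0::'a::euclidean_space) 1) F f d"
    and contF: "\<And>t. continuous_on (sphere 0 1) (F t)"
    and contf: "continuous_on (sphere 0 1) f" and contd: "continuous_on (sphere 0 1) d"
    and const: "\<And>t. (\<integral>z. F t z \<partial>sphere_measure) = (\<integral>z. f z \<partial>sphere_measure)"
  shows "(\<integral>z. d z \<partial>sphere_measure) = 0"
proof (rule ccontr)
  let ?I = "\<integral>z. d z \<partial>sphere_measure"
  assume I: "?I \<noteq> 0"
  obtain K where K: "\<And>t z. t \<in> {0..1} \<Longrightarrow> z \<in> sphere 0 1 \<Longrightarrow>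
     cmod (F t z - f z - of_real t * d z) \<le> K * t\<^sup>2"
    using fo unfolding first_order_on_def by blast
  \<comment> \<open>\<open>F t\<close> and \<open>f\<close> have equal integrals, so the integrated
    remainder is \<open>- t\<close> times the integral of \<open>d\<close>. Its bound
    \<open>K * t\<^sup>2\<close>, divided by \<open>t\<close>, tends to 0.\<close>
  have le: "cmod ?I \<le> K * t" if t: "0 < t" "t \<le> 1" for t
  proof -
    note int = integrable_sphere_measure[OF contF] integrable_sphere_measure[OF contf]
      integrable_sphere_measure[OF contd]
    have "(\<integral>z. F t z - f z - of_real t * d z \<partial>sphere_measure) = - of_real t * ?I"
      using int const[of t] by simp
    moreover have "cmod (\<integral>z. F t z - f z - of_real t * d z \<partial>sphere_measure) \<le> (\<integral>z. K * t\<^sup>2 \<partial>(sphere_measure :: 'a measure))"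
      using int K t
      by (intro order_trans[OF integral_norm_bound] integral_mono integrable_norm) (auto simp: space_sphere_measure)
    ultimately have "t * cmod ?I \<le> K * t\<^sup>2"
      using t by (simp add: norm_mult sphere.prob_space)
    also have "\<dots> = t * (K * t)" by (simp add: power2_eq_square)
    finally show ?thesis using t by (simp only: mult_le_cancel_left_pos)
  qed
  have "((\<lambda>t. K * t) \<longlongrightarrow> K * 0) (at_right 0)"
    by (intro tendsto_intros)
  moreover have "\<forall>\<^sub>F t in at_right 0. cmod ?I \<le> K * t"
    by (rule eventually_mono[OF eventually_at_right_real[OF zero_less_one]]) (simp add: le)
  ultimately have "cmod ?I \<le> 0"
    by (intro tendsto_lowerbound[of "\<lambda>t. K * t" _ "at_right 0"]) auto
  then show False using I by simp
qed

text \<open>Unitary invariance makes the moment constant along the phase rotations of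
  \<open>v\<close>. By the product rule its derivative at 0 is this integral times
  \<open>\<i>\<close>.\<close>

lemma sphere_commutator_identity_unit:
  fixes v :: "complex ^ 'n"
  assumes v: "norm v = 1"
  shows "(\<integral>z. quad_form_comm v v A z * quad_form B z * quad_form C z * quad_form D z
      + quad_form A z * quad_form_comm v v B z * quad_form C z * quad_form D z
      + quad_form A z * quad_form B z * quad_form_comm v v C z * quad_form D z
      + quad_form A z * quad_form B z * quad_form C z * quad_form_comm v v D z \<partial>sphere_measure) = 0"
    (is "(\<integral>z. ?d z \<partial>_) = 0")
proof -
  let ?U = "phase_rotation v"
  let ?f = "\<lambda>z. quad_form A z * quad_form B z * quad_form C z * quad_form D z"
  note fo = first_order_on_quad_form_phase_rotation[OF v]
  have U: "continuous_on S (?U t)" for S t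
    unfolding phase_rotation_def vector_scalar_mult_def
    by (intro continuous_intros)
  have "first_order_on (sphere 0 1) (\<lambda>t z. ?f (?U t z)) ?f (\<lambda>z. \<i> * ?d z)"
    using first_order_on_mult[OF first_order_on_mult[OF first_order_on_mult[OF fo fo] fo] fo, of A B C D]
    by (simp add: algebra_simps)
  then have "(\<integral>z. \<i> * ?d z \<partial>sphere_measure) = 0"
  proof (rule first_order_on_sphere_integral_zero)
    show "(\<integral>z. ?f (?U t z) \<partial>sphere_measure) = (\<integral>z. ?f z \<partial>sphere_measure)" for t
      by (rule integral_sphere_measure_orthogonal_transformation)
         (auto intro!: orthogonal_transformation_phase_rotation v continuous_intros)
  qed (intro continuous_intros U)+
  then show ?thesis by simp
qed

text \<open>The integrand is sesquilinear in \<open>v\<close> and \<open>w\<close>: scaling removes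
  the norm condition of the diagonal case, and the diagonal case determines the rest.\<close>

lemma sphere_commutator_identity:
  fixes v w :: "complex ^ 'n"
  shows "(\<integral>z. quad_form_comm v w A z * quad_form B z * quad_form C z * quad_form D z
      + quad_form A z * quad_form_comm v w B z * quad_form C z * quad_form D z
      + quad_form A z * quad_form B z * quad_form_comm v w C z * quad_form D z
      + quad_form A z * quad_form B z * quad_form C z * quad_form_comm v w D z \<partial>sphere_measure) = 0"
proof -
  define G where "G = (\<lambda>v w z. quad_form_comm v w A z * quad_form B z * quad_form C z * quad_form D z
      + quad_form A z * quad_form_comm v w B z * quad_form C z * quad_form D z
      + quad_form A z * quad_form B z * quad_form_comm v w C z * quad_form D z
      + quad_form A z * quad_form B z * quad_form C z * quad_form_comm v w D z)"
  have comm_scale: "quad_form_comm (c *s v) (c *s v) M z = c * cnj c * quad_form_comm v v M z" for c v M z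
    by (simp add: quad_form_comm_def matrix_vector_mult_vector_scale hinner_simps algebra_simps)
  have G_diag: "(\<integral>z. G v v z \<partial>sphere_measure) = 0" for v
  proof (cases "v = 0")
    case True then show ?thesis by (simp add: G_def quad_form_comm_def)
  next
    case False
    define c where "c = complex_of_real (norm v)"
    define u where "u = inverse c *s v"
    have u: "norm u = 1"
      using False by (simp add: u_def c_def of_real_vector_scale flip: of_real_inverse)
    have v: "v = c *s u" using False by (simp add: u_def c_def)
    have "quad_form_comm v v M z = c * cnj c * quad_form_comm u u M z" for M z
      using comm_scale[of c u M z] by (simp flip: v)
    then have "G v v z = c * cnj c * G u u z" for z
      by (simp add: G_def algebra_simps)
    then show ?thesis
      using sphere_commutator_identity_unit[OF u, of A B C D] by (simp add: G_def)
  qed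
  have int: "integrable sphere_measure (G v w)" for v w
    unfolding G_def by (intro integrable_sphere_measure continuous_intros)
  \<comment> \<open>polarization of the sesquilinear form in \<open>v\<close> and \<open>w\<close>\<close>
  have comm_polar: "2 * quad_form_comm v w M z =
      (quad_form_comm (v + w) (v + w) M z - quad_form_comm v v M z - quad_form_comm w w M z)
      + \<i> * (quad_form_comm (v + \<i> *s w) (v + \<i> *s w) M z - quad_form_comm v v M z - quad_form_comm w w M z)" for M z
    by (simp add: quad_form_comm_def matrix_vector_right_distrib matrix_vector_mult_vector_scale hinner_simps algebra_simps)
  have "2 * G v w z = (G (v + w) (v + w) z - G v v z - G w w z)
      + \<i> * (G (v + \<i> *s w) (v + \<i> *s w) z - G v v z - G w w z)" for z
  proof -
    have "2 * G v w z = (2 * quad_form_comm v w A z) * quad_form B z * quad_form C z * quad_form D z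
      + quad_form A z * (2 * quad_form_comm v w B z) * quad_form C z * quad_form D z
      + quad_form A z * quad_form B z * (2 * quad_form_comm v w C z) * quad_form D z
      + quad_form A z * quad_form B z * quad_form C z * (2 * quad_form_comm v w D z)"
      by (simp add: G_def algebra_simps)
    then show ?thesis unfolding comm_polar G_def by (simp add: algebra_simps)
  qed
  then have "(\<integral>z. 2 * G v w z \<partial>sphere_measure) = 0"
    by (simp add: int G_diag)
  then have "(\<integral>z. G v w z \<partial>sphere_measure) = 0" by simp
  then show ?thesis unfolding G_def .
qed

section \<open>Summation over matrix units\<close>

definition outer :: "complex ^ 'n \<Rightarrow> complex ^ 'n \<Rightarrow> complex ^ 'n ^ 'n" where
  "outer a b = (\<chi> k l. a $ k * cnj (b $ l))"

lemma outer_mult_vector: "outer a b *v x = hinner x b *s a"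
  by (simp add: outer_def vec_eq_iff matrix_vector_mult_def hinner_def sum_distrib_left mult_ac)

lemma hinner_axis_right: "hinner z (axis i 1) = z $ i"
  by (simp add: hinner_def axis_def if_distrib cong: if_cong)

lemma hinner_axis_left: "hinner (axis i 1) z = cnj (z $ i)"
  using cnj_hinner[of z "axis i 1"] by (simp add: hinner_axis_right)

lemma hinner_matrix_expand:
  "hinner (A *v x) z = (\<Sum>j\<in>UNIV. hinner (A *v axis j 1) z * x $ j)"
proof -
  have "A *v x = (\<Sum>j\<in>UNIV. x $ j *s (A *v axis j 1))"
    by (simp add: vec_eq_iff matrix_vector_mult_def axis_def if_distrib mult.commute cong: if_cong)
  then show ?thesis by (simp add: hinner_sum_left hinner_scale_left mult.commute)
qed

definition sphere_moment :: "complex ^ 'n ^ 'n \<Rightarrow> complex ^ 'n ^ 'n \<Rightarrow> complex ^ 'n ^ 'n \<Rightarrow> complex ^ 'n ^ 'n \<Rightarrow> complex" where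
  "sphere_moment A B C D = (\<integral>z. quad_form A z * quad_form B z * quad_form C z * quad_form D z \<partial>sphere_measure)"

lemma sphere_moment_recursion:
  fixes A :: "complex ^ 'n ^ 'n"
  shows "(of_nat CARD('n) + 3) * sphere_moment A B C D =
    trace A * sphere_moment (mat 1) B C D + sphere_moment (mat 1) (A ** B) C D
    + sphere_moment (mat 1) B (A ** C) D + sphere_moment (mat 1) B C (A ** D)"
proof -
  define n where "n = (of_nat CARD('n) :: complex)"
  let ?e = "\<lambda>i. axis i 1 :: complex ^ 'n"
  \<comment> \<open>\<open>E i j\<close> is \<open>A\<close> times the matrix unit with its one at
    \<open>(j, i)\<close>, while the commutators below are taken with the unit at
    \<open>(i, j)\<close>.\<close>
  define E where "E = (\<lambda>i j. outer (A *v ?e j) (?e i))"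
  define G where "G = (\<lambda>i j z. quad_form_comm (?e i) (?e j) (E i j) z * quad_form B z * quad_form C z * quad_form D z
      + quad_form (E i j) z * quad_form_comm (?e i) (?e j) B z * quad_form C z * quad_form D z
      + quad_form (E i j) z * quad_form B z * quad_form_comm (?e i) (?e j) C z * quad_form D z
      + quad_form (E i j) z * quad_form B z * quad_form C z * quad_form_comm (?e i) (?e j) D z)"
  have G0: "(\<integral>z. G i j z \<partial>sphere_measure) = 0" for i j
    unfolding G_def by (rule sphere_commutator_identity)
  have int_G: "integrable sphere_measure (G i j)" for i j
    unfolding G_def by (intro integrable_sphere_measure continuous_intros)
  have qE: "quad_form (E i j) z = z $ i * hinner (A *v ?e j) z" for i j z
    by (simp add: quad_form_def E_def outer_mult_vector hinner_scale_left hinner_axis_right)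
  have cE: "quad_form_comm (?e i) (?e j) (E i j) z = hinner (A *v ?e j) z * z $ j - z $ i * cnj (z $ i) * A $ j $ j" for i j z
  proof -
    have "(A *v ?e j) $ j = A $ j $ j"
      by (simp add: matrix_vector_mult_def axis_def if_distrib cong: if_cong)
    then show ?thesis
      by (simp add: quad_form_comm_def E_def outer_mult_vector hinner_scale_left hinner_axis_right hinner_axis_left)
  qed
  have cM: "quad_form_comm (?e i) (?e j) M z = hinner (M *v ?e i) z * z $ j - cnj (z $ i) * (M *v z) $ j" for i j M z
    by (simp add: quad_form_comm_def hinner_axis_right hinner_axis_left)
  \<comment> \<open>As matrices the commutators are \<open>A E_jj - A_jj E_ii\<close>. They add up
    to \<open>n A\<close> minus \<open>trace A\<close> times the identity, whose form is 1 on the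
    sphere.\<close>
  have sum1: "(\<Sum>i\<in>UNIV. \<Sum>j\<in>UNIV. quad_form_comm (?e i) (?e j) (E i j) z) = n * quad_form A z - trace A"
    if z: "z \<in> sphere 0 1" for z
  proof -
    have zz: "(\<Sum>i\<in>UNIV. z $ i * cnj (z $ i)) = 1"
      using z hinner_self[of z] by (simp add: hinner_def)
    have "(\<Sum>i\<in>UNIV. \<Sum>j\<in>UNIV. quad_form_comm (?e i) (?e j) (E i j) z) =
        n * (\<Sum>j\<in>UNIV. hinner (A *v ?e j) z * z $ j) - (\<Sum>i\<in>UNIV. z $ i * cnj (z $ i)) * trace A"
      by (simp add: cE sum_subtractf n_def sum_product trace_def)
    then show ?thesis by (simp add: zz quad_form_def flip: hinner_matrix_expand)
  qed
  \<comment> \<open>The double sum splits into products of sums over \<open>i\<close> and over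
    \<open>j\<close>. Expansion in the standard basis evaluates them, and one of the factors is the
    squared norm of \<open>z\<close>.\<close>
  have sum2: "(\<Sum>i\<in>UNIV. \<Sum>j\<in>UNIV. quad_form (E i j) z * quad_form_comm (?e i) (?e j) M z) =
      quad_form A z * quad_form M z - quad_form (A ** M) z"
    if z: "z \<in> sphere 0 1" for z M
  proof -
    have zz: "(\<Sum>i\<in>UNIV. z $ i * cnj (z $ i)) = 1"
      using z hinner_self[of z] by (simp add: hinner_def)
    have "(\<Sum>i\<in>UNIV. \<Sum>j\<in>UNIV. quad_form (E i j) z * quad_form_comm (?e i) (?e j) M z) =
        (\<Sum>i\<in>UNIV. hinner (M *v ?e i) z * z $ i) * (\<Sum>j\<in>UNIV. hinner (A *v ?e j) z * z $ j)
        - (\<Sum>i\<in>UNIV. z $ i * cnj (z $ i)) * (\<Sum>j\<in>UNIV. hinner (A *v ?e j) z * (M *v z) $ j)"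
      unfolding sum_product qE cM sum_subtractf[symmetric]
      by (intro sum.cong refl) (simp add: algebra_simps)
    then show ?thesis
      by (simp add: zz quad_form_def matrix_vector_mul_assoc mult.commute[of "hinner (M *v z) z"] flip: hinner_matrix_expand)
  qed
  \<comment> \<open>The product of all four forms occurs \<open>n\<close> times from the first slot
    and once from each of the others, whence the factor \<open>n + 3\<close>.\<close>
  define R where "R = (\<lambda>z. (n * quad_form A z - trace A) * quad_form B z * quad_form C z * quad_form D z
      + (quad_form A z * quad_form B z - quad_form (A ** B) z) * quad_form C z * quad_form D z
      + (quad_form A z * quad_form C z - quad_form (A ** C) z) * quad_form B z * quad_form D z
      + (quad_form A z * quad_form D z - quad_form (A ** D) z) * quad_form B z * quad_form C z)"
  have sumG: "(\<Sum>i\<in>UNIV. \<Sum>j\<in>UNIV. G i j z) = R z" if z: "z \<in> sphere 0 1" for z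
  proof -
    have "(\<Sum>i\<in>UNIV. \<Sum>j\<in>UNIV. G i j z) =
      (\<Sum>i\<in>UNIV. \<Sum>j\<in>UNIV. quad_form_comm (?e i) (?e j) (E i j) z) * (quad_form B z * quad_form C z * quad_form D z)
      + (\<Sum>i\<in>UNIV. \<Sum>j\<in>UNIV. quad_form (E i j) z * quad_form_comm (?e i) (?e j) B z) * (quad_form C z * quad_form D z)
      + (\<Sum>i\<in>UNIV. \<Sum>j\<in>UNIV. quad_form (E i j) z * quad_form_comm (?e i) (?e j) C z) * (quad_form B z * quad_form D z)
      + (\<Sum>i\<in>UNIV. \<Sum>j\<in>UNIV. quad_form (E i j) z * quad_form_comm (?e i) (?e j) D z) * (quad_form B z * quad_form C z)"
      unfolding sum_distrib_right sum.distrib[symmetric] G_def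
      by (intro sum.cong refl) (simp add: mult_ac)
    then show ?thesis unfolding sum1[OF z] sum2[OF z] R_def by (simp add: mult.assoc)
  qed
  define m where "m = (\<lambda>A B C D z. quad_form A z * quad_form B z * quad_form C z * quad_form (D :: complex ^ 'n ^ 'n) z)"
  have int_m: "integrable sphere_measure (m A B C D)" for A B C D
    unfolding m_def by (intro integrable_sphere_measure continuous_intros)
  have integral_m: "integral\<^sup>L sphere_measure (m A B C D) = sphere_moment A B C D" for A B C D
    by (simp add: m_def sphere_moment_def)
  have "0 = (\<Sum>i\<in>UNIV. \<Sum>j\<in>UNIV. \<integral>z. G i j z \<partial>sphere_measure)"
    by (simp add: G0)
  also have "\<dots> = (\<integral>z. (\<Sum>i\<in>UNIV. \<Sum>j\<in>UNIV. G i j z) \<partial>sphere_measure)"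
    by (simp add: int_G)
  \<comment> \<open>Products of three forms are padded with the form of \<open>mat 1\<close>, so
    that every term becomes a \<open>sphere_moment\<close>.\<close>
  also have "\<dots> = (\<integral>z. (n + 3) * m A B C D z - trace A * m (mat 1) B C D z
      - m (mat 1) (A ** B) C D z - m (mat 1) B (A ** C) D z - m (mat 1) B C (A ** D) z \<partial>sphere_measure)"
  proof (rule Bochner_Integration.integral_cong)
    fix z assume "z \<in> space (sphere_measure :: (complex ^ 'n) measure)"
    then have z: "z \<in> sphere 0 1" by (simp add: space_sphere_measure)
    then show "(\<Sum>i\<in>UNIV. \<Sum>j\<in>UNIV. G i j z) = (n + 3) * m A B C D z - trace A * m (mat 1) B C D z
      - m (mat 1) (A ** B) C D z - m (mat 1) B (A ** C) D z - m (mat 1) B C (A ** D) z"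
      unfolding sumG[OF z] R_def m_def by (simp add: quad_form_mat_1 algebra_simps)
  qed simp
  also have "\<dots> = (n + 3) * sphere_moment A B C D - trace A * sphere_moment (mat 1) B C D
    - sphere_moment (mat 1) (A ** B) C D - sphere_moment (mat 1) B (A ** C) D - sphere_moment (mat 1) B C (A ** D)"
    by (simp add: int_m integral_m)
  finally show ?thesis by (simp add: n_def algebra_simps)
qed

section \<open>Moments of order one to four\<close>

text \<open>Each trace sum runs over the permutations of its arguments and multiplies the traces along the cycles.\<close>

definition trace_sum2 :: "complex ^ 'n ^ 'n \<Rightarrow> complex ^ 'n ^ 'n \<Rightarrow> complex" where
  "trace_sum2 A B = trace A * trace B + trace (A ** B)"

definition trace_sum3 :: "complex ^ 'n ^ 'n \<Rightarrow> complex ^ 'n ^ 'n \<Rightarrow> complex ^ 'n ^ 'n \<Rightarrow> complex" where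
  "trace_sum3 A B C = trace A * trace_sum2 B C + trace_sum2 (A ** B) C + trace_sum2 B (A ** C)"

definition trace_sum4 :: "complex ^ 'n ^ 'n \<Rightarrow> complex ^ 'n ^ 'n \<Rightarrow> complex ^ 'n ^ 'n \<Rightarrow> complex ^ 'n ^ 'n \<Rightarrow> complex" where
  "trace_sum4 A B C D = trace A * trace_sum3 B C D + trace_sum3 (A ** B) C D
     + trace_sum3 B (A ** C) D + trace_sum3 B C (A ** D)"

text \<open>In the recursion, multiplying \<open>A\<close> into an identity argument gives back the
  same moment by symmetry. Three such terms move to the left and lower \<open>n + 3\<close> to
  \<open>n\<close>.\<close>

lemma sphere_moment_1:
  fixes A :: "complex ^ 'n ^ 'n"
  defines "n \<equiv> of_nat CARD('n) :: complex"
  shows "n * sphere_moment A (mat 1) (mat 1) (mat 1) = trace A"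
proof -
  have "sphere_moment (mat 1) (mat 1) (mat 1) (mat 1 :: complex ^ 'n ^ 'n) = (\<integral>z. 1 \<partial>(sphere_measure :: (complex ^ 'n) measure))"
    unfolding sphere_moment_def
    by (intro Bochner_Integration.integral_cong) (auto simp: quad_form_mat_1 space_sphere_measure)
  then have one: "sphere_moment (mat 1) (mat 1) (mat 1) (mat 1 :: complex ^ 'n ^ 'n) = 1"
    by (simp add: sphere.prob_space)
  have c: "sphere_moment (mat 1) A (mat 1) (mat 1) = sphere_moment A (mat 1) (mat 1) (mat 1)"
    "sphere_moment (mat 1) (mat 1) A (mat 1) = sphere_moment A (mat 1) (mat 1) (mat 1)"
    "sphere_moment (mat 1) (mat 1) (mat 1) A = sphere_moment A (mat 1) (mat 1) (mat 1)"
    by (simp_all add: sphere_moment_def mult_ac)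
  have "(n + 3) * sphere_moment A (mat 1) (mat 1) (mat 1) = trace A + 3 * sphere_moment A (mat 1) (mat 1) (mat 1)"
    using sphere_moment_recursion[of A "mat 1" "mat 1" "mat 1"] by (simp add: one n_def c)
  then show ?thesis by (simp add: algebra_simps)
qed

text \<open>Two identity slots reproduce the moment and lower \<open>n + 3\<close> to
  \<open>n + 1\<close>. The other terms are moments of order one.\<close>

lemma sphere_moment_2:
  fixes A B :: "complex ^ 'n ^ 'n"
  defines "n \<equiv> of_nat CARD('n) :: complex"
  shows "n * (n + 1) * sphere_moment A B (mat 1) (mat 1) = trace_sum2 A B"
proof -
  let ?I = "mat 1 :: complex ^ 'n ^ 'n"
  have c: "sphere_moment ?I X ?I ?I = sphere_moment X ?I ?I ?I"
    "sphere_moment ?I B A ?I = sphere_moment A B ?I ?I"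
    "sphere_moment ?I B ?I A = sphere_moment A B ?I ?I" for X
    by (simp_all add: sphere_moment_def mult_ac)
  have "(n + 3) * sphere_moment A B ?I ?I = trace A * sphere_moment B ?I ?I ?I
      + sphere_moment (A ** B) ?I ?I ?I + 2 * sphere_moment A B ?I ?I"
    using sphere_moment_recursion[of A B ?I ?I] by (simp add: n_def c)
  then have "(n + 1) * sphere_moment A B ?I ?I = trace A * sphere_moment B ?I ?I ?I + sphere_moment (A ** B) ?I ?I ?I"
    by (simp add: algebra_simps)
  then have "n * ((n + 1) * sphere_moment A B ?I ?I) =
      trace A * (n * sphere_moment B ?I ?I ?I) + n * sphere_moment (A ** B) ?I ?I ?I"
    by (simp add: algebra_simps)
  then show ?thesis unfolding n_def sphere_moment_1 by (simp add: trace_sum2_def mult.assoc)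
qed

lemma sphere_moment_3:
  fixes A B C :: "complex ^ 'n ^ 'n"
  defines "n \<equiv> of_nat CARD('n) :: complex"
  shows "n * (n + 1) * (n + 2) * sphere_moment A B C (mat 1) = trace_sum3 A B C"
proof -
  let ?I = "mat 1 :: complex ^ 'n ^ 'n"
  have c: "sphere_moment ?I X Y ?I = sphere_moment X Y ?I ?I" "sphere_moment ?I B C A = sphere_moment A B C ?I" for X Y
    by (simp_all add: sphere_moment_def mult_ac)
  have "(n + 3) * sphere_moment A B C ?I = trace A * sphere_moment B C ?I ?I
      + sphere_moment (A ** B) C ?I ?I + sphere_moment B (A ** C) ?I ?I + sphere_moment A B C ?I"
    using sphere_moment_recursion[of A B C ?I] by (simp add: n_def c)
  then have "(n + 2) * sphere_moment A B C ?I = trace A * sphere_moment B C ?I ?I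
      + sphere_moment (A ** B) C ?I ?I + sphere_moment B (A ** C) ?I ?I"
    by (simp add: algebra_simps)
  then have "n * (n + 1) * ((n + 2) * sphere_moment A B C ?I) =
      trace A * (n * (n + 1) * sphere_moment B C ?I ?I)
      + n * (n + 1) * sphere_moment (A ** B) C ?I ?I + n * (n + 1) * sphere_moment B (A ** C) ?I ?I"
    by (simp only: distrib_left mult_ac)
  then show ?thesis unfolding n_def sphere_moment_2 by (simp add: trace_sum3_def mult.assoc)
qed

text \<open>All four slots carry general matrices, so no term of the recursion is absorbed on the
  left and the full factor \<open>n + 3\<close> remains.\<close>

lemma sphere_moment_4:
  fixes A B C D :: "complex ^ 'n ^ 'n"
  defines "n \<equiv> of_nat CARD('n) :: complex"
  shows "n * (n + 1) * (n + 2) * (n + 3) * sphere_moment A B C D = trace_sum4 A B C D"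
proof -
  let ?I = "mat 1 :: complex ^ 'n ^ 'n"
  have c: "sphere_moment ?I X Y Z = sphere_moment X Y Z ?I" for X Y Z
    by (simp add: sphere_moment_def mult_ac)
  have *: "(n + 3) * sphere_moment A B C D = trace A * sphere_moment B C D ?I
      + sphere_moment (A ** B) C D ?I + sphere_moment B (A ** C) D ?I + sphere_moment B C (A ** D) ?I"
    using sphere_moment_recursion[of A B C D] by (simp only: n_def c)
  have "n * (n + 1) * (n + 2) * ((n + 3) * sphere_moment A B C D) =
      trace A * (n * (n + 1) * (n + 2) * sphere_moment B C D ?I)
      + n * (n + 1) * (n + 2) * sphere_moment (A ** B) C D ?I
      + n * (n + 1) * (n + 2) * sphere_moment B (A ** C) D ?I
      + n * (n + 1) * (n + 2) * sphere_moment B C (A ** D) ?I"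
    by (subst *) (simp add: algebra_simps)
  then show ?thesis unfolding n_def sphere_moment_3 by (simp add: trace_sum4_def mult.assoc)
qed

subsection \<open>Central moments\<close>

text \<open>The conjugate of the form is the form of the adjoint, so the fourth power of the modulus
  is a polynomial in two forms. A general \<open>c\<close> covers both the raw moment,
  \<open>c = 0\<close>, and the central one.\<close>

lemma sphere_moment_central4:
  fixes A :: "complex ^ 'n ^ 'n" and c :: complex
  defines "A' \<equiv> ctranspose A" and "I \<equiv> mat 1"
  shows "complex_of_real (\<integral>z. cmod (quad_form A z - c) ^ 4 \<partial>sphere_measure) =
    sphere_moment A A A' A' - 2 * c * sphere_moment A A' A' I - 2 * cnj c * sphere_moment A A A' I
    + c\<^sup>2 * sphere_moment A' A' I I + (cnj c)\<^sup>2 * sphere_moment A A I I + 4 * c * cnj c * sphere_moment A A' I I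
    - 2 * c * (cnj c)\<^sup>2 * sphere_moment A I I I - 2 * c\<^sup>2 * cnj c * sphere_moment A' I I I + c\<^sup>2 * (cnj c)\<^sup>2"
proof -
  define m where "m = (\<lambda>A B C D z. quad_form A z * quad_form B z * quad_form C z * quad_form (D :: complex ^ 'n ^ 'n) z)"
  have int_m: "integrable sphere_measure (m A B C D)" for A B C D
    unfolding m_def by (intro integrable_sphere_measure continuous_intros)
  have integral_m: "integral\<^sup>L sphere_measure (m A B C D) = sphere_moment A B C D" for A B C D
    by (simp add: m_def sphere_moment_def)
  have "complex_of_real (\<integral>z. cmod (quad_form A z - c) ^ 4 \<partial>sphere_measure) =
    (\<integral>z. complex_of_real (cmod (quad_form A z - c) ^ 4) \<partial>sphere_measure)"
    by (rule integral_complex_of_real[symmetric])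
  also have "\<dots> = (\<integral>z. m A A A' A' z - (2 * c) * m A A' A' I z - (2 * cnj c) * m A A A' I z
    + c\<^sup>2 * m A' A' I I z + (cnj c)\<^sup>2 * m A A I I z + (4 * c * cnj c) * m A A' I I z
    - (2 * c * (cnj c)\<^sup>2) * m A I I I z - (2 * c\<^sup>2 * cnj c) * m A' I I I z + c\<^sup>2 * (cnj c)\<^sup>2 \<partial>sphere_measure)"
  proof (rule Bochner_Integration.integral_cong)
    fix z assume "z \<in> space (sphere_measure :: (complex ^ 'n) measure)"
    then have I: "quad_form I z = 1" by (simp add: space_sphere_measure I_def quad_form_mat_1)
    have "complex_of_real (cmod (quad_form A z - c) ^ 4) = (complex_of_real ((cmod (quad_form A z - c))\<^sup>2))\<^sup>2"
      by simp
    also have "\<dots> = ((quad_form A z - c) * (quad_form A' z - cnj c))\<^sup>2"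
      by (simp only: complex_norm_square complex_cnj_diff cnj_quad_form A'_def)
    finally show "complex_of_real (cmod (quad_form A z - c) ^ 4) =
      m A A A' A' z - (2 * c) * m A A' A' I z - (2 * cnj c) * m A A A' I z
      + c\<^sup>2 * m A' A' I I z + (cnj c)\<^sup>2 * m A A I I z + (4 * c * cnj c) * m A A' I I z
      - (2 * c * (cnj c)\<^sup>2) * m A I I I z - (2 * c\<^sup>2 * cnj c) * m A' I I I z + c\<^sup>2 * (cnj c)\<^sup>2"
      by (simp add: m_def I power2_eq_square algebra_simps)
  qed simp
  also have "\<dots> = sphere_moment A A A' A' - 2 * c * sphere_moment A A' A' I - 2 * cnj c * sphere_moment A A A' I
    + c\<^sup>2 * sphere_moment A' A' I I + (cnj c)\<^sup>2 * sphere_moment A A I I + 4 * c * cnj c * sphere_moment A A' I I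
    - 2 * c * (cnj c)\<^sup>2 * sphere_moment A I I I - 2 * c\<^sup>2 * cnj c * sphere_moment A' I I I + c\<^sup>2 * (cnj c)\<^sup>2"
    by (simp add: int_m integral_m sphere.prob_space)
  finally show ?thesis .
qed

lemma sphere_moment_central2:
  fixes A :: "complex ^ 'n ^ 'n" and c :: complex
  defines "A' \<equiv> ctranspose A" and "I \<equiv> mat 1"
  shows "complex_of_real (\<integral>z. (cmod (quad_form A z - c))\<^sup>2 \<partial>sphere_measure) =
    sphere_moment A A' I I - c * sphere_moment A' I I I - cnj c * sphere_moment A I I I + c * cnj c"
proof -
  define m where "m = (\<lambda>A B C D z. quad_form A z * quad_form B z * quad_form C z * quad_form (D :: complex ^ 'n ^ 'n) z)"
  have int_m: "integrable sphere_measure (m A B C D)" for A B C D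
    unfolding m_def by (intro integrable_sphere_measure continuous_intros)
  have integral_m: "integral\<^sup>L sphere_measure (m A B C D) = sphere_moment A B C D" for A B C D
    by (simp add: m_def sphere_moment_def)
  have "complex_of_real (\<integral>z. (cmod (quad_form A z - c))\<^sup>2 \<partial>sphere_measure) =
    (\<integral>z. complex_of_real ((cmod (quad_form A z - c))\<^sup>2) \<partial>sphere_measure)"
    by (rule integral_complex_of_real[symmetric])
  also have "\<dots> = (\<integral>z. m A A' I I z - c * m A' I I I z - cnj c * m A I I I z + c * cnj c \<partial>sphere_measure)"
  proof (rule Bochner_Integration.integral_cong)
    fix z assume "z \<in> space (sphere_measure :: (complex ^ 'n) measure)"
    then have I: "quad_form I z = 1" by (simp add: space_sphere_measure I_def quad_form_mat_1)
    have "complex_of_real ((cmod (quad_form A z - c))\<^sup>2) = (quad_form A z - c) * (quad_form A' z - cnj c)"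
      by (simp only: complex_norm_square complex_cnj_diff cnj_quad_form A'_def)
    then show "complex_of_real ((cmod (quad_form A z - c))\<^sup>2) =
      m A A' I I z - c * m A' I I I z - cnj c * m A I I I z + c * cnj c"
      by (simp add: m_def I algebra_simps)
  qed simp
  also have "\<dots> = sphere_moment A A' I I - c * sphere_moment A' I I I - cnj c * sphere_moment A I I I + c * cnj c"
    by (simp add: int_m integral_m sphere.prob_space)
  finally show ?thesis .
qed

section \<open>Assembly of the identity from traces\<close>

lemma integral_quad_form: "(\<integral>z. quad_form A z \<partial>sphere_measure) = sphere_moment A (mat 1) (mat 1) (mat 1)"
  unfolding sphere_moment_def
  by (intro Bochner_Integration.integral_cong) (auto simp: quad_form_mat_1 space_sphere_measure)

theorem corollary4p3:
  fixes A :: "complex ^ 'n ^ 'n" and \<alpha> :: real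
  assumes "\<alpha> \<ge> 0"
  shows "let n = real CARD('n);
             d = n * (n + 1) * (n + 2);
             \<sigma> = (sphere_measure :: (complex ^ 'n) measure);
             f = quad_form A
         in 3 * d * (\<integral>\<xi>. (cmod (f \<xi>)) ^ 4 \<partial>\<sigma>) + n * d * central_moment4 \<sigma> f
              + 4 * \<alpha> * n\<^sup>2 * (n + 1)\<^sup>2 * (cvariance \<sigma> f)\<^sup>2
          = 4 * (frobenius_norm (A ** A))\<^sup>2 + 2 * (schatten4_norm A) ^ 4
              + (2 + 4 * \<alpha>) * (frobenius_norm A) ^ 4
              + 4 / n * Re (trace (A ** A) * (trace (ctranspose A))\<^sup>2)
              + 8 / n * (1 - \<alpha>) * (frobenius_norm A)\<^sup>2 * (cmod (trace A))\<^sup>2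
              + (cmod (trace (A ** A)))\<^sup>2
              + (3 * n - 6 + 4 * \<alpha>) / n\<^sup>2 * (cmod (trace A)) ^ 4"
proof -
  define r where "r = real CARD('n)"
  define n where "n = complex_of_real r"
  define \<sigma> where "\<sigma> = (sphere_measure :: (complex ^ 'n) measure)"
  have r: "r > 0" by (simp add: r_def)
  have n_of_nat: "of_nat CARD('n) = n" by (simp add: n_def r_def)
  have n0: "n \<noteq> 0" and n3: "n + 3 \<noteq> 0"
    using r by (auto simp: n_def complex_eq_iff)
  define A' where "A' = ctranspose A"
  let ?I = "mat 1 :: complex ^ 'n ^ 'n"
  \<comment> \<open>with \<open>tr A = n c\<close> every quantity below becomes a polynomial in \<open>n\<close>\<close>
  define c where "c = trace A / n"
  define c' where "c' = cnj c"
  define q where "q = trace (A ** A)"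
  define q' where "q' = cnj q"
  define s where "s = trace (A ** A')"
  define u where "u = trace (A ** A ** A')"
  define u' where "u' = trace (A ** A' ** A')"
  define w where "w = trace (A ** A ** A' ** A')"
  define x where "x = trace (A ** A' ** A ** A')"
  have trace_ctranspose: "trace (ctranspose B) = cnj (trace B)" for B :: "complex ^ 'n ^ 'n"
    by (simp add: trace_def ctranspose_def)
  have tr1: "trace A = n * c" "trace A' = n * c'"
    using n0 by (simp_all add: c_def c'_def A'_def trace_ctranspose n_def)
  have tr2: "trace (A' ** A') = q'" "trace (A' ** A) = s"
    by (simp_all add: q'_def q_def s_def A'_def trace_mul_sym[of "ctranspose A" A]
        flip: trace_ctranspose ctranspose_mult)
  \<comment> \<open>Cyclic invariance reduces each word of length three or four in \<open>A\<close>
    and \<open>A'\<close> to one of the chosen representatives.\<close>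
  have tr3: "trace (A ** A' ** A) = u" "trace (A' ** A ** A) = u"
    "trace (A' ** A ** A') = u'" "trace (A' ** A' ** A) = u'"
    using trace_mul_sym[of A "A' ** A"] trace_mul_sym[of A' "A ** A"]
      trace_mul_sym[of A' "A ** A'"] trace_mul_sym[of "A' ** A'" A]
    by (simp_all add: u_def u'_def matrix_mul_assoc)
  have tr4: "trace (A ** A' ** A' ** A) = w" "trace (A' ** A' ** A ** A) = w" "trace (A' ** A ** A ** A') = w"
    "trace (A' ** A ** A' ** A) = x"
    using trace_mul_sym[of "A ** A' ** A'" A] trace_mul_sym[of "A' ** A'" "A ** A"]
      trace_mul_sym[of A' "A ** A ** A'"] trace_mul_sym[of A' "A ** A' ** A"]
    by (simp_all add: w_def x_def matrix_mul_assoc)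
  note tr = tr1 tr2 tr3 tr4 q_def[symmetric] s_def[symmetric] u_def[symmetric] u'_def[symmetric]
    w_def[symmetric] x_def[symmetric]
  note trace_sums = trace_sum4_def trace_sum3_def trace_sum2_def matrix_mul_assoc tr
  note m1 = sphere_moment_1[where 'n='n, unfolded n_of_nat]
  note m2 = sphere_moment_2[where 'n='n, unfolded n_of_nat]
  note m3 = sphere_moment_3[where 'n='n, unfolded n_of_nat]
  note m4 = sphere_moment_4[where 'n='n, unfolded n_of_nat]
  have e1: "sphere_moment A ?I ?I ?I = c" "sphere_moment A' ?I ?I ?I = c'"
    using m1[of A] m1[of A'] n0 by (simp_all add: tr)
  have e2: "n * (n + 1) * sphere_moment A A ?I ?I = n\<^sup>2 * c\<^sup>2 + q"
    "n * (n + 1) * sphere_moment A' A' ?I ?I = n\<^sup>2 * c'\<^sup>2 + q'"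
    "n * (n + 1) * sphere_moment A A' ?I ?I = n\<^sup>2 * c * c' + s"
    unfolding m2 by (simp_all add: trace_sums power2_eq_square)
  have e3: "n * (n + 1) * (n + 2) * sphere_moment A A A' ?I = n^3 * c\<^sup>2 * c' + n * q * c' + 2 * n * c * s + 2 * u"
    "n * (n + 1) * (n + 2) * sphere_moment A A' A' ?I = n^3 * c * c'\<^sup>2 + n * q' * c + 2 * n * c' * s + 2 * u'"
    unfolding m3 by (simp_all add: trace_sums power2_eq_square power3_eq_cube algebra_simps)
  have e4: "n * (n + 1) * (n + 2) * (n + 3) * sphere_moment A A A' A' =
    n^4 * c\<^sup>2 * c'\<^sup>2 + n\<^sup>2 * q * c'\<^sup>2 + n\<^sup>2 * q' * c\<^sup>2 + 4 * n\<^sup>2 * c * c' * s + q * q' + 2 * s\<^sup>2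
    + 4 * n * c' * u + 4 * n * c * u' + 4 * w + 2 * x"
    unfolding m4 by (simp add: trace_sums power2_eq_square power4_eq_xxxx algebra_simps)
  have mean: "(\<integral>z. quad_form A z \<partial>\<sigma>) = c"
    unfolding \<sigma>_def integral_quad_form by (rule e1)
  define E4 where "E4 = complex_of_real (\<integral>z. cmod (quad_form A z) ^ 4 \<partial>\<sigma>)"
  define \<mu> where "\<mu> = complex_of_real (central_moment4 \<sigma> (quad_form A))"
  define V where "V = complex_of_real (cvariance \<sigma> (quad_form A))"
  have E4: "E4 = sphere_moment A A A' A'"
    unfolding E4_def \<sigma>_def using sphere_moment_central4[of A 0] by (simp add: A'_def)
  \<comment> \<open>With \<open>c\<close> the mean, the last three terms of the expansion merge,
    with coefficient -2 - 2 + 1 = -3.\<close>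
  have \<mu>: "\<mu> = sphere_moment A A A' A' - 2 * c * sphere_moment A A' A' ?I - 2 * c' * sphere_moment A A A' ?I
    + c\<^sup>2 * sphere_moment A' A' ?I ?I + c'\<^sup>2 * sphere_moment A A ?I ?I + 4 * c * c' * sphere_moment A A' ?I ?I
    - 3 * c\<^sup>2 * c'\<^sup>2"
    unfolding \<mu>_def central_moment4_def mean
    using sphere_moment_central4[of A c]
    by (simp add: \<sigma>_def e1 flip: A'_def c'_def) (simp add: power2_eq_square)
  have V: "V = sphere_moment A A' ?I ?I - c * c'"
    unfolding V_def cvariance_def mean
    using sphere_moment_central2[of A c]
    by (simp add: \<sigma>_def e1 flip: A'_def c'_def)
  have V': "n * (n + 1) * V = s - n * c * c'"
    unfolding V right_diff_distrib e2 by (simp add: power2_eq_square algebra_simps)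
  \<comment> \<open>Each moment is grouped with the factor that turns it into a trace polynomial in
    \<open>e2\<close>, \<open>e3\<close> and \<open>e4\<close>.\<close>
  have \<mu>': "n * (n + 1) * (n + 2) * (n + 3) * \<mu> =
    (n * (n + 1) * (n + 2) * (n + 3) * sphere_moment A A A' A')
    - 2 * c * (n + 3) * (n * (n + 1) * (n + 2) * sphere_moment A A' A' ?I)
    - 2 * c' * (n + 3) * (n * (n + 1) * (n + 2) * sphere_moment A A A' ?I)
    + (n + 2) * (n + 3) * (c\<^sup>2 * (n * (n + 1) * sphere_moment A' A' ?I ?I)
       + c'\<^sup>2 * (n * (n + 1) * sphere_moment A A ?I ?I) + 4 * c * c' * (n * (n + 1) * sphere_moment A A' ?I ?I))
    - 3 * n * (n + 1) * (n + 2) * (n + 3) * c\<^sup>2 * c'\<^sup>2"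
    unfolding \<mu> by algebra
  \<comment> \<open>The factor \<open>n + 3\<close> clears the denominator of the fourth moment. The
    coefficients of \<open>c' * u\<close> and of \<open>c * u'\<close> are both
    \<open>12 * n + 4 * n\<^sup>2 - 4 * n * (n + 3) = 0\<close>.\<close>
  have "(n + 3) * (3 * (n * (n + 1) * (n + 2)) * E4 + n * (n * (n + 1) * (n + 2)) * \<mu>) =
    3 * (n * (n + 1) * (n + 2) * (n + 3) * sphere_moment A A A' A') + n * (n * (n + 1) * (n + 2) * (n + 3) * \<mu>)"
    unfolding E4 by algebra
  also have "\<dots> = (n + 3) * (4 * w + 2 * x + 2 * s\<^sup>2 + 2 * n * (q * c'\<^sup>2 + q' * c\<^sup>2) + 8 * n * s * c * c'
      + q * q' + (3 * n - 6) * n\<^sup>2 * c\<^sup>2 * c'\<^sup>2)"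
    unfolding \<mu>' e2 e3 e4 by algebra
  finally have main: "3 * (n * (n + 1) * (n + 2)) * E4 + n * (n * (n + 1) * (n + 2)) * \<mu> =
    4 * w + 2 * x + 2 * s\<^sup>2 + 2 * n * (q * c'\<^sup>2 + q' * c\<^sup>2) + 8 * n * s * c * c'
      + q * q' + (3 * n - 6) * n\<^sup>2 * c\<^sup>2 * c'\<^sup>2"
    using n3 by simp
  define a where "a = complex_of_real \<alpha>"
  \<comment> \<open>The weight of the squared variance is the square of the denominator
    \<open>n * (n + 1)\<close> of \<open>V\<close>.\<close>
  have "4 * a * n\<^sup>2 * (n + 1)\<^sup>2 * V\<^sup>2 = 4 * a * (n * (n + 1) * V)\<^sup>2"
    by (simp add: power_mult_distrib)
  also have "\<dots> = 4 * a * (s - n * c * c')\<^sup>2" unfolding V' ..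
  finally have lhs: "3 * (n * (n + 1) * (n + 2)) * E4 + n * (n * (n + 1) * (n + 2)) * \<mu>
      + 4 * a * n\<^sup>2 * (n + 1)\<^sup>2 * V\<^sup>2 =
    4 * w + 2 * x + (2 + 4 * a) * s\<^sup>2 + 2 * n * (q * c'\<^sup>2 + q' * c\<^sup>2) + 8 * n * (1 - a) * s * (c * c')
      + q * q' + (3 * n - 6 + 4 * a) * n\<^sup>2 * (c * c')\<^sup>2"
    unfolding main by algebra
  have fA: "complex_of_real ((frobenius_norm A)\<^sup>2) = s"
    by (simp only: frobenius_norm_square s_def A'_def)
  have fA4: "complex_of_real ((frobenius_norm A) ^ 4) = s\<^sup>2"
    unfolding fA[symmetric] by (simp flip: power_mult)
  have fAA: "complex_of_real ((frobenius_norm (A ** A))\<^sup>2) = w"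
    by (simp only: frobenius_norm_square ctranspose_mult w_def A'_def matrix_mul_assoc)
  have sA: "complex_of_real ((schatten4_norm A) ^ 4) = x"
    by (simp only: schatten4_norm_power4 x_def A'_def)
  have qq: "complex_of_real ((cmod q)\<^sup>2) = q * q'"
    by (simp only: complex_norm_square q'_def)
  have tt: "complex_of_real ((cmod (trace A))\<^sup>2) = n\<^sup>2 * (c * c')"
    unfolding complex_norm_square tr1
    by (simp add: c'_def n_def power2_eq_square)
  have tt4: "complex_of_real ((cmod (trace A)) ^ 4) = (n\<^sup>2 * (c * c'))\<^sup>2"
    unfolding tt[symmetric] by (simp flip: power_mult)
  have re: "complex_of_real (Re (q * (trace A')\<^sup>2)) = n\<^sup>2 * (q * c'\<^sup>2 + q' * c\<^sup>2) / 2"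
  proof -
    have "complex_of_real (2 * Re (q * (trace A')\<^sup>2)) = q * (trace A')\<^sup>2 + cnj (q * (trace A')\<^sup>2)"
      by (rule complex_add_cnj[symmetric])
    also have "\<dots> = n\<^sup>2 * (q * c'\<^sup>2 + q' * c\<^sup>2)"
      by (simp add: tr1 q'_def c'_def n_def algebra_simps)
    finally have "2 * complex_of_real (Re (q * (trace A')\<^sup>2)) = n\<^sup>2 * (q * c'\<^sup>2 + q' * c\<^sup>2)"
      by (simp only: of_real_mult of_real_numeral)
    moreover have "y = z / 2" if "2 * y = z" for y z :: complex
      by (simp flip: that)
    ultimately show ?thesis by (simp only:)
  qed
  have rhs: "complex_of_real (4 * (frobenius_norm (A ** A))\<^sup>2 + 2 * (schatten4_norm A) ^ 4
              + (2 + 4 * \<alpha>) * (frobenius_norm A) ^ 4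
              + 4 / r * Re (q * (trace A')\<^sup>2)
              + 8 / r * (1 - \<alpha>) * (frobenius_norm A)\<^sup>2 * (cmod (trace A))\<^sup>2
              + (cmod q)\<^sup>2
              + (3 * r - 6 + 4 * \<alpha>) / r\<^sup>2 * (cmod (trace A)) ^ 4) =
    4 * w + 2 * x + (2 + 4 * a) * s\<^sup>2 + 2 * n * (q * c'\<^sup>2 + q' * c\<^sup>2) + 8 * n * (1 - a) * s * (c * c')
      + q * q' + (3 * n - 6 + 4 * a) * n\<^sup>2 * (c * c')\<^sup>2"
  proof -
    have "complex_of_real (4 * (frobenius_norm (A ** A))\<^sup>2 + 2 * (schatten4_norm A) ^ 4
              + (2 + 4 * \<alpha>) * (frobenius_norm A) ^ 4
              + 4 / r * Re (q * (trace A')\<^sup>2)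
              + 8 / r * (1 - \<alpha>) * (frobenius_norm A)\<^sup>2 * (cmod (trace A))\<^sup>2
              + (cmod q)\<^sup>2
              + (3 * r - 6 + 4 * \<alpha>) / r\<^sup>2 * (cmod (trace A)) ^ 4) =
      4 * w + 2 * x + (2 + 4 * a) * s\<^sup>2
        + 4 / n * (n\<^sup>2 * (q * c'\<^sup>2 + q' * c\<^sup>2) / 2) + 8 / n * (1 - a) * s * (n\<^sup>2 * (c * c'))
        + q * q' + (3 * n - 6 + 4 * a) / n\<^sup>2 * (n\<^sup>2 * (c * c'))\<^sup>2"
      unfolding of_real_add of_real_mult of_real_divide of_real_diff fA fA4 fAA sA qq tt tt4 re
      by (simp add: n_def a_def)
    also have "\<dots> = 4 * w + 2 * x + (2 + 4 * a) * s\<^sup>2 + 2 * n * (q * c'\<^sup>2 + q' * c\<^sup>2) + 8 * n * (1 - a) * s * (c * c')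
      + q * q' + (3 * n - 6 + 4 * a) * n\<^sup>2 * (c * c')\<^sup>2"
      using n0 by (simp add: power2_eq_square)
    finally show ?thesis .
  qed
  \<comment> \<open>The computation took place in the complex numbers; injectivity of
    \<open>complex_of_real\<close> returns it to the reals.\<close>
  have "complex_of_real (3 * (r * (r + 1) * (r + 2)) * (\<integral>z. cmod (quad_form A z) ^ 4 \<partial>\<sigma>)
      + r * (r * (r + 1) * (r + 2)) * central_moment4 \<sigma> (quad_form A)
      + 4 * \<alpha> * r\<^sup>2 * (r + 1)\<^sup>2 * (cvariance \<sigma> (quad_form A))\<^sup>2) =
    3 * (n * (n + 1) * (n + 2)) * E4 + n * (n * (n + 1) * (n + 2)) * \<mu>
      + 4 * a * n\<^sup>2 * (n + 1)\<^sup>2 * V\<^sup>2"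
    by (simp only: n_def E4_def \<mu>_def V_def a_def of_real_add of_real_mult of_real_power of_real_1 of_real_numeral)
  then show ?thesis
    unfolding lhs rhs[symmetric] of_real_eq_iff
    by (simp add: Let_def r_def \<sigma>_def q_def A'_def)
qed

end
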